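(* Let $L=\mathbb{F}_q$ be the finite field with $q=p^l$ elements, $p$ a prime, and let $K$ be one of the fields $L((t_1))$, $L((t_1))((t_2))$, $L((t_1))((t_2))((t_3))$, and so on (i.e. $K=L((t_1))\cdots((t_n))$ for some integer $n\ge 1$). Let $\mathcal{L}_{\rm ring}=(+,-,\cdot,0,1)$ be the language of rings. Then $K_0(K,\mathcal{L}_{\rm ring})=0$, and there exists an $\mathcal{L}_{\rm ring}$-definable bijection $K\to K^\times$, where $K^\times=K\setminus\{0\}$.
   Context: Iterated Laurent series fields: $L((t_1))$ is the field of formal Laurent series in $t_1$ over $L$, and inductively $L((t_1))\cdots((t_n))$ is the field of formal Laurent series in $t_n$ over $L((t_1))\cdots((t_{n-1}))$. Definable always means definable with parameters. A function is definable if its graph is. Grothendieck ring: let $\mathcal{L}$ be a language and $M$ an $\mathcal{L}$-structure. For $\mathcal{L}$-definable sets $X\subset M^m$, $Y\subset M^n$ ($m,n>0$), write $X\cong_{\mathcal{L}}Y$ if there is an $\mathcal{L}$-definable bijection $X\to Y$. $K_0(M,\mathcal{L})$ is the abelian group generated by symbols $[A]$, for $A$ an $\mathcal{L}$-definable set, with the relations $[A]=[A']$ if $A\cong_{\mathcal{L}}A'$, and $[A]=[B]+[C]$ if $A$ is the disjoint union of the definable sets $B$ and $C$; it is a ring with multiplication induced by $[A\times B]=[A][B]$ (the unit is the class of a point). *)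

theory Defs
  imports
    "HOL-Algebra.Algebra"
    "HOL-Algebra.Algebraic_Closure_Type"
    "HOL-Computational_Algebra.Formal_Laurent_Series"
begin

section \<open>Iterated Laurent series\<close>

text \<open>
  The library type \<open>'a fls\<close> cannot be iterated a variable number of times, since every iteration
  changes the type. We therefore define Laurent series over a ring given as a record.
  In the product, only the finitely many indices with two nonzero factors are summed over.
\<close>

definition laurent_ring :: "('a, 'b) ring_scheme \<Rightarrow> (int \<Rightarrow> 'a) ring" where
  "laurent_ring R =
     \<lparr>carrier = {f. range f \<subseteq> carrier R \<and> (\<exists>N. \<forall>i<N. f i = \<zero>\<^bsub>R\<^esub>)},
      monoid.mult = (\<lambda>f g n. \<Oplus>\<^bsub>R\<^esub>i\<in>{i. f i \<noteq> \<zero>\<^bsub>R\<^esub> \<and> g (n - i) \<noteq> \<zero>\<^bsub>R\<^esub>}. f i \<otimes>\<^bsub>R\<^esub> g (n - i)),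
      monoid.one = (\<lambda>n. if n = 0 then \<one>\<^bsub>R\<^esub> else \<zero>\<^bsub>R\<^esub>),
      ring.zero = (\<lambda>_. \<zero>\<^bsub>R\<^esub>),
      ring.add = (\<lambda>f g n. f n \<oplus>\<^bsub>R\<^esub> g n)\<rparr>"

text \<open>Over a field given as a type, this is the library's ring of formal Laurent series.\<close>

lemma finsum_ring_of_type_algebra:
  fixes f :: "'i \<Rightarrow> 'a :: comm_ring_1"
  assumes "finite A"
  shows "finsum (ring_of_type_algebra :: 'a ring) f A = sum f A"
proof -
  let ?F = "ring_of_type_algebra :: 'a ring"
  interpret cring ?F by (rule cring_from_type_algebra)
  have F: "carrier ?F = UNIV" "x \<oplus>\<^bsub>?F\<^esub> y = x + y" "\<zero>\<^bsub>?F\<^esub> = 0" for x y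
    by (simp_all add: ring_of_type_algebra_def)
  show ?thesis
    using assms by (induction A rule: finite_induct) (simp_all add: F)
qed

lemma fls_nth_ring_iso:
  "fls_nth \<in> ring_iso (ring_of_type_algebra :: 'a :: field fls ring)
                      (laurent_ring (ring_of_type_algebra :: 'a ring))"
proof (rule ring_iso_memI)
  let ?F = "ring_of_type_algebra :: 'a ring"
  have bounded: "\<exists>N. \<forall>i<N. fls_nth f i = 0" for f :: "'a fls"
    by (meson fls_eq0_below_subdegree)
  show "fls_nth x \<in> carrier (laurent_ring ?F)" for x :: "'a fls"
    using bounded by (auto simp: laurent_ring_def ring_of_type_algebra_def)
  show "fls_nth (x \<otimes>\<^bsub>ring_of_type_algebra\<^esub> y) =
        fls_nth x \<otimes>\<^bsub>laurent_ring ?F\<^esub> fls_nth y" for x y :: "'a fls"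
  proof
    fix n
    let ?A = "{i. fls_nth x i \<noteq> 0 \<and> fls_nth y (n - i) \<noteq> 0}"
    have sub: "?A \<subseteq> {fls_subdegree x..n - fls_subdegree y}"
    proof
      fix i assume "i \<in> ?A"
      then have "i \<ge> fls_subdegree x" "n - i \<ge> fls_subdegree y"
        using fls_eq0_below_subdegree not_le by blast+
      then show "i \<in> {fls_subdegree x..n - fls_subdegree y}" by simp
    qed
    then have fin: "finite ?A"
      by (rule finite_subset) simp
    have "fls_nth (x * y) n = (\<Sum>i\<in>{fls_subdegree x..n - fls_subdegree y}. fls_nth x i * fls_nth y (n - i))"
      by (rule fls_times_nth(2))
    also have "\<dots> = (\<Sum>i\<in>?A. fls_nth x i * fls_nth y (n - i))"
      by (rule sum.mono_neutral_right) (use sub in auto)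
    also have "\<dots> = finsum ?F (\<lambda>i. fls_nth x i * fls_nth y (n - i)) ?A"
      by (rule finsum_ring_of_type_algebra [OF fin, symmetric])
    finally show "fls_nth (x \<otimes>\<^bsub>ring_of_type_algebra\<^esub> y) n =
        (fls_nth x \<otimes>\<^bsub>laurent_ring ?F\<^esub> fls_nth y) n"
      by (simp add: laurent_ring_def ring_of_type_algebra_def)
  qed
  show "fls_nth (x \<oplus>\<^bsub>ring_of_type_algebra\<^esub> y) =
        fls_nth x \<oplus>\<^bsub>laurent_ring ?F\<^esub> fls_nth y" for x y :: "'a fls"
    by (auto simp: laurent_ring_def ring_of_type_algebra_def)
  show "fls_nth \<one>\<^bsub>ring_of_type_algebra :: 'a fls ring\<^esub> = \<one>\<^bsub>laurent_ring ?F\<^esub>"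
    by (auto simp: laurent_ring_def ring_of_type_algebra_def)
  have "f \<in> range fls_nth" if N: "\<forall>i<N. f i = 0" for f :: "int \<Rightarrow> 'a" and N
  proof
    show "f = fls_nth (Abs_fls f)"
      using nth_Abs_fls_lower_bound [OF N] by auto
  qed simp
  moreover have "inj (fls_nth :: 'a fls \<Rightarrow> _)"
    by (auto intro!: injI simp: fls_eq_iff)
  ultimately show "bij_betw fls_nth (carrier (ring_of_type_algebra :: 'a fls ring)) (carrier (laurent_ring ?F))"
    using bounded by (auto simp: bij_betw_def laurent_ring_def ring_of_type_algebra_def)
qed

text \<open>
  A single type for the elements of all the fields L((t_1))...((t_n)), with n arbitrary.
  The outermost \<open>Series\<close> is the expansion in the last variable t_n.
\<close>

datatype 'a iter_series = Base 'a | Series "int \<Rightarrow> 'a iter_series"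

primrec iter_laurent :: "('a, 'b) ring_scheme \<Rightarrow> nat \<Rightarrow> 'a iter_series ring" where
  "iter_laurent L 0 = image_ring Base L"
| "iter_laurent L (Suc n) = image_ring Series (laurent_ring (iter_laurent L n))"

section \<open>Definable sets in the language of rings\<close>

datatype ring_term =
    Var nat
  | Zero
  | One
  | Plus ring_term ring_term
  | Minus ring_term ring_term
  | Times ring_term ring_term

datatype ring_formula =
    Eq ring_term ring_term
  | Neg ring_formula
  | Conj ring_formula ring_formula
  | Ex nat ring_formula

primrec eval_term :: "('a, 'b) ring_scheme \<Rightarrow> (nat \<Rightarrow> 'a) \<Rightarrow> ring_term \<Rightarrow> 'a" where
  "eval_term R e (Var i) = e i"
| "eval_term R e Zero = \<zero>\<^bsub>R\<^esub>"
| "eval_term R e One = \<one>\<^bsub>R\<^esub>"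
| "eval_term R e (Plus s t) = eval_term R e s \<oplus>\<^bsub>R\<^esub> eval_term R e t"
| "eval_term R e (Minus s t) = eval_term R e s \<ominus>\<^bsub>R\<^esub> eval_term R e t"
| "eval_term R e (Times s t) = eval_term R e s \<otimes>\<^bsub>R\<^esub> eval_term R e t"

primrec sat :: "('a, 'b) ring_scheme \<Rightarrow> (nat \<Rightarrow> 'a) \<Rightarrow> ring_formula \<Rightarrow> bool" where
  "sat R e (Eq s t) \<longleftrightarrow> eval_term R e s = eval_term R e t"
| "sat R e (Neg \<phi>) \<longleftrightarrow> \<not> sat R e \<phi>"
| "sat R e (Conj \<phi> \<psi>) \<longleftrightarrow> sat R e \<phi> \<and> sat R e \<psi>"
| "sat R e (Ex i \<phi>) \<longleftrightarrow> (\<exists>a\<in>carrier R. sat R (e(i := a)) \<phi>)"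

text \<open>
  Points of the m-th Cartesian power are lists of length m. The variables below m stand for the
  coordinates of the point, and the free variables from m on are assigned parameters by \<open>e\<close>
  (a formula mentions only finitely many of them).
\<close>

definition tuples :: "('a, 'b) ring_scheme \<Rightarrow> nat \<Rightarrow> 'a list set" where
  "tuples R m = {xs. length xs = m \<and> set xs \<subseteq> carrier R}"

definition definable :: "('a, 'b) ring_scheme \<Rightarrow> nat \<Rightarrow> 'a list set \<Rightarrow> bool" where
  "definable R m A \<longleftrightarrow>
     (\<exists>\<phi> e. range e \<subseteq> carrier R \<and>
        A = {xs \<in> tuples R m. sat R (\<lambda>i. if i < m then xs ! i else e i) \<phi>})"

definition definable_bij ::
    "('a, 'b) ring_scheme \<Rightarrow> ('a list \<Rightarrow> 'a list) \<Rightarrow> 'a list set \<Rightarrow> 'a list set \<Rightarrow> bool" where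
  "definable_bij R f A B \<longleftrightarrow>
     bij_betw f A B \<and>
     (\<exists>m>0. \<exists>n>0. definable R m A \<and> definable R n B \<and> definable R (m + n) {x @ f x |x. x \<in> A})"

definition points :: "'a set \<Rightarrow> 'a list set" where
  "points S = {[x] |x. x \<in> S}"

section \<open>The Grothendieck ring\<close>

definition definable_sets :: "('a, 'b) ring_scheme \<Rightarrow> 'a list set set" where
  "definable_sets R = {A. \<exists>m>0. definable R m A}"

definition cart_prod :: "'a list set \<Rightarrow> 'a list set \<Rightarrow> 'a list set" where
  "cart_prod A B = {x @ y |x y. x \<in> A \<and> y \<in> B}"

text \<open>
  The free abelian group on the definable sets with the biadditive multiplication extending the
  Cartesian product. The element \<open>one\<close>, the generator of a one-point set, becomes a unit only in
  the quotient below.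
\<close>

definition K0_free :: "('a, 'b) ring_scheme \<Rightarrow> ('a list set \<Rightarrow>\<^sub>0 int) ring" where
  "K0_free R =
     \<lparr>carrier = carrier (free_Abelian_group (definable_sets R)),
      monoid.mult = (\<lambda>a b. frag_extend (\<lambda>A. frag_extend (\<lambda>B. frag_of (cart_prod A B)) b) a),
      monoid.one = frag_of (points {\<zero>\<^bsub>R\<^esub>}),
      ring.zero = 0,
      ring.add = (+)\<rparr>"

definition K0_relators :: "('a, 'b) ring_scheme \<Rightarrow> ('a list set \<Rightarrow>\<^sub>0 int) set" where
  "K0_relators R =
     {frag_of A - frag_of B |A B. \<exists>f. definable_bij R f A B} \<union>
     {frag_of A - (frag_of B + frag_of C) |A B C.
        \<exists>m>0. definable R m A \<and> definable R m B \<and> definable R m C \<and> A = B \<union> C \<and> B \<inter> C = {}}"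

definition K0 :: "('a, 'b) ring_scheme \<Rightarrow> ('a list set \<Rightarrow>\<^sub>0 int) set ring" where
  "K0 R = K0_free R Quot generate (free_Abelian_group (definable_sets R)) (K0_relators R)"

end

theory Submission
  imports Defs
begin

text \<open>
  It suffices to find a definable bijection from \<open>K\<close> onto the nonzero elements: multiplied by any
  definable set \<open>A\<close>, it shows that the class of \<open>A\<close> vanishes (lemma \<open>K0_trivial\<close>). As \<open>K\<close> is the
  union of any definable subset \<open>Y\<close> and its complement, it is enough to have a definable bijection
  from \<open>Y\<close> onto \<open>Y\<close> minus a point (lemma \<open>carrier_equiv_nonzeroI\<close>).

  The field \<open>K\<close> carries a Henselian valuation with value group \<open>\<int>\<^sup>n\<close> in lexicographic order and
  residue field \<open>L\<close> with \<open>q\<close> elements. The value of \<open>t = t_1\<close> is the least positive one, so the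
  maximal ideal of the valuation ring \<open>V\<close> is \<open>t V\<close>. Let \<open>m = q\<^sup>2 - 1\<close>, which is prime to \<open>p\<close>, at
  least 2, and a multiple of \<open>q - 1\<close>. Then \<open>V\<close> is definable, as \<open>x\<close> lies in \<open>V\<close> if and only if
  \<open>1 + t x\<^sup>m\<close> is an \<open>m\<close>-th power (lemma \<open>in_V_iff\<close>).

  Write \<open>X\<close> for the set of nonzero elements of \<open>V\<close>, and \<open>A \<sim> B\<close> for definable equivalence. An
  \<open>m\<close>-th power in \<open>V\<close> that is a unit is a principal unit, and all principal units are \<open>m\<close>-th powers.
  Hence multiplication by \<open>t\<^sup>m\<close> maps the nonzero \<open>m\<close>-th powers in \<open>V\<close> bijectively onto those that
  are not principal units, and the map equal to it on \<open>m\<close>-th powers and to the identity elsewhere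
  shows that \<open>X\<close> is equivalent to the complement in it of the set \<open>1 + t V\<close> of principal units
  (lemma \<open>shrink_image\<close>). Since \<open>1 + t V\<close> is \<open>{1}\<close> together with a copy of \<open>X\<close>, this gives
  \<open>X \<sim> 1 + 2 X\<close>, where sums are disjoint unions and 1 is a point. On the other hand \<open>X\<^sup>2 \<sim> 2 X\<^sup>2\<close>:
  of a pair \<open>(x, y)\<close>, either \<open>x\<close> divides \<open>y\<close>, and the pair is \<open>(x, x z)\<close>, or \<open>t y\<close> divides \<open>x\<close>,
  and the pair is \<open>(t z y, y)\<close>. Therefore
  \<open>X\<^sup>2 \<sim> (1 + 2 X) X \<sim> X + 2 X\<^sup>2 \<sim> X + X\<^sup>2\<close>, and \<open>X\<^sup>2 \<sim> X + X\<^sup>2 \<sim> 1 + 2 X + X\<^sup>2 \<sim> 1 + X\<^sup>2\<close>.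
  So \<open>X\<^sup>2\<close> can lose a point. Finally \<open>(x, y) \<mapsto> x\<^sup>p + t y\<^sup>p\<close> embeds \<open>X\<^sup>2\<close> into \<open>K\<close>, since the
  Frobenius map is additive and \<open>t\<close> is not a \<open>p\<close>-th power; its image is the wanted set \<open>Y\<close>
  (lemma \<open>carrier_equiv_nonzero\<close>).

  The existence of \<open>m\<close>-th roots of principal units is proved by induction on the number of
  variables. As \<open>m + 1 = q\<^sup>2\<close>, the equation \<open>y\<^sup>m = u\<close> reads \<open>y\<^sup>Q = u y\<close> with \<open>Q = q\<^sup>2\<close>, which is
  additive in \<open>y\<close> and can be solved coefficient by coefficient (lemma \<open>power_series_root\<close>).
\<close>

section \<open>Definable predicates on assignments\<close>

primrec rename_term :: "(nat \<Rightarrow> nat) \<Rightarrow> ring_term \<Rightarrow> ring_term" where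
  "rename_term \<rho> (Var i) = Var (\<rho> i)"
| "rename_term \<rho> Zero = Zero"
| "rename_term \<rho> One = One"
| "rename_term \<rho> (Plus s t) = Plus (rename_term \<rho> s) (rename_term \<rho> t)"
| "rename_term \<rho> (Minus s t) = Minus (rename_term \<rho> s) (rename_term \<rho> t)"
| "rename_term \<rho> (Times s t) = Times (rename_term \<rho> s) (rename_term \<rho> t)"

text \<open>Bound variables are renamed as well, which avoids capture as long as \<open>\<rho>\<close> is injective.\<close>

primrec rename_formula :: "(nat \<Rightarrow> nat) \<Rightarrow> ring_formula \<Rightarrow> ring_formula" where
  "rename_formula \<rho> (Eq s t) = Eq (rename_term \<rho> s) (rename_term \<rho> t)"
| "rename_formula \<rho> (Neg \<phi>) = Neg (rename_formula \<rho> \<phi>)"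
| "rename_formula \<rho> (Conj \<phi> \<psi>) = Conj (rename_formula \<rho> \<phi>) (rename_formula \<rho> \<psi>)"
| "rename_formula \<rho> (Ex i \<phi>) = Ex (\<rho> i) (rename_formula \<rho> \<phi>)"

lemma eval_rename_term: "eval_term R e (rename_term \<rho> s) = eval_term R (\<lambda>i. e (\<rho> i)) s"
  by (induction s) auto

lemma sat_rename_formula:
  assumes "inj \<rho>"
  shows "sat R e (rename_formula \<rho> \<phi>) \<longleftrightarrow> sat R (\<lambda>i. e (\<rho> i)) \<phi>"
proof (induction \<phi> arbitrary: e)
  case (Ex i \<phi>)
  have "(\<lambda>j. (e(\<rho> i := a)) (\<rho> j)) = (\<lambda>j. e (\<rho> j))(i := a)" for a
    using injD [OF assms] by (auto simp: fun_eq_iff)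
  then show ?case by (simp add: Ex)
qed (simp_all add: eval_rename_term)

text \<open>
  The assignment in which the even variables take the values of \<open>v\<close> and the odd ones the values of
  \<open>c\<close>.
\<close>

definition slots :: "(nat \<Rightarrow> 'a) \<Rightarrow> (nat \<Rightarrow> 'a) \<Rightarrow> nat \<Rightarrow> 'a" where
  "slots v c i = (if even i then v (i div 2) else c (i div 2))"

text \<open>
  A predicate on assignments \<open>v\<close> is definable if it is expressed by a formula whose even variables stand for \<open>v\<close> and whose odd variables are assigned parameters \<open>c\<close>. Keeping
  infinitely many variables in reserve for both makes the closure properties below free of any
  bookkeeping of arities.
\<close>

definition def_pred :: "('a, 'b) ring_scheme \<Rightarrow> ((nat \<Rightarrow> 'a) \<Rightarrow> bool) \<Rightarrow> bool" where
  "def_pred R P \<longleftrightarrow>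
     (\<exists>\<phi> c. range c \<subseteq> carrier R \<and>
        (\<forall>v. range v \<subseteq> carrier R \<longrightarrow> (P v \<longleftrightarrow> sat R (slots v c) \<phi>)))"

lemma slots_even [simp]: "slots v c (2 * i) = v i" "slots v c (i * 2) = v i"
  and slots_odd [simp]: "slots v c (Suc (2 * i)) = c i" "slots v c (Suc (i * 2)) = c i"
  by (simp_all add: slots_def)

lemma def_predI:
  assumes "range c \<subseteq> carrier R"
    and "\<And>v. range v \<subseteq> carrier R \<Longrightarrow> P v \<longleftrightarrow> sat R (slots v c) \<phi>"
  shows "def_pred R P"
  using assms unfolding def_pred_def by blast

lemma inj_slots:
  assumes "inj f" "inj g" "\<And>i j. f i \<noteq> g j"
  shows "inj (slots f g)"
proof (rule injI)
  fix i j assume "slots f g i = slots f g j"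
  with assms have "even i = even j \<and> i div 2 = j div 2"
    unfolding slots_def by (metis injD)
  then show "i = j" by (metis even_two_times_div_two odd_two_times_div_two_succ)
qed

text \<open>
  The formula of a definable predicate may be transported to other slots: variable \<open>i\<close> to \<open>f i\<close>
  and parameter \<open>i\<close> to \<open>g i\<close>.
\<close>

lemma def_pred_reslot:
  assumes "def_pred R Q"
  shows "\<exists>\<phi> c. range c \<subseteq> carrier R \<and>
    (\<forall>f g v e. inj (slots f g) \<longrightarrow> range v \<subseteq> carrier R \<longrightarrow> (\<forall>i. e (f i) = v i) \<longrightarrow>
       (\<forall>i. e (g i) = c i) \<longrightarrow> (Q v \<longleftrightarrow> sat R e (rename_formula (slots f g) \<phi>)))"
proof -
  obtain \<phi> c where c: "range c \<subseteq> carrier R"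
    and Q: "\<And>v. range v \<subseteq> carrier R \<Longrightarrow> Q v \<longleftrightarrow> sat R (slots v c) \<phi>"
    using assms unfolding def_pred_def by blast
  have "Q v \<longleftrightarrow> sat R e (rename_formula (slots f g) \<phi>)"
    if "inj (slots f g)" "range v \<subseteq> carrier R" "\<forall>i. e (f i) = v i" "\<forall>i. e (g i) = c i" for f g v e
  proof -
    have "(\<lambda>i. e (slots f g i)) = slots v c"
      using that(3,4) by (auto simp: slots_def)
    then show ?thesis using that(1,2) by (simp add: sat_rename_formula Q)
  qed
  with c show ?thesis by blast
qed

lemma def_pred_cong:
  assumes "def_pred R P" and "\<And>v. range v \<subseteq> carrier R \<Longrightarrow> P v \<longleftrightarrow> Q v"
  shows "def_pred R Q"
  using assms unfolding def_pred_def by (metis (no_types, lifting))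

lemma def_pred_not:
  assumes "def_pred R P"
  shows "def_pred R (\<lambda>v. \<not> P v)"
proof -
  obtain \<phi> c where "range c \<subseteq> carrier R"
    and P: "\<And>v. range v \<subseteq> carrier R \<Longrightarrow> P v \<longleftrightarrow> sat R (slots v c) \<phi>"
    using assms unfolding def_pred_def by blast
  then show ?thesis by (intro def_predI [of c R _ "Neg \<phi>"]) auto
qed

lemma def_pred_conj:
  assumes "def_pred R P" "def_pred R Q"
  shows "def_pred R (\<lambda>v. P v \<and> Q v)"
proof -
  obtain \<phi> c where c: "range c \<subseteq> carrier R"
    and P: "\<forall>f g v e. inj (slots f g) \<longrightarrow> range v \<subseteq> carrier R \<longrightarrow> (\<forall>i. e (f i) = v i) \<longrightarrow>
       (\<forall>i. e (g i) = c i) \<longrightarrow> (P v \<longleftrightarrow> sat R e (rename_formula (slots f g) \<phi>))"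
    using def_pred_reslot [OF assms(1)] by blast
  obtain \<psi> d where d: "range d \<subseteq> carrier R"
    and Q: "\<forall>f g v e. inj (slots f g) \<longrightarrow> range v \<subseteq> carrier R \<longrightarrow> (\<forall>i. e (f i) = v i) \<longrightarrow>
       (\<forall>i. e (g i) = d i) \<longrightarrow> (Q v \<longleftrightarrow> sat R e (rename_formula (slots f g) \<psi>))"
    using def_pred_reslot [OF assms(2)] by blast
  \<comment> \<open>The parameters of the two formulas are interleaved.\<close>
  have inj: "inj (slots ((*) 2) (\<lambda>i. Suc (2 * (2 * i))))"
      "inj (slots ((*) 2) (\<lambda>i. Suc (2 * Suc (2 * i))))"
    by (intro inj_slots injI; presburger)+
  let ?\<phi> = "rename_formula (slots ((*) 2) (\<lambda>i. Suc (2 * (2 * i)))) \<phi>"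
  let ?\<psi> = "rename_formula (slots ((*) 2) (\<lambda>i. Suc (2 * Suc (2 * i)))) \<psi>"
  show ?thesis
  proof (rule def_predI)
    show "range (slots c d) \<subseteq> carrier R" using c d by (auto simp: slots_def)
    fix v :: "nat \<Rightarrow> 'a" assume v: "range v \<subseteq> carrier R"
    have "P v \<longleftrightarrow> sat R (slots v (slots c d)) ?\<phi>"
      by (rule P [rule_format, OF inj(1) v]) (simp_all only: slots_even slots_odd)
    moreover have "Q v \<longleftrightarrow> sat R (slots v (slots c d)) ?\<psi>"
      by (rule Q [rule_format, OF inj(2) v]) (simp_all only: slots_even slots_odd)
    ultimately show "P v \<and> Q v \<longleftrightarrow> sat R (slots v (slots c d)) (Conj ?\<phi> ?\<psi>)"
      by simp
  qed
qed

lemma def_pred_disj: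
  assumes "def_pred R P" "def_pred R Q"
  shows "def_pred R (\<lambda>v. P v \<or> Q v)"
  using def_pred_not [OF def_pred_conj [OF def_pred_not def_pred_not, OF assms]] by simp

lemma def_pred_rename:
  assumes "def_pred R P" "inj \<rho>"
  shows "def_pred R (\<lambda>v. P (\<lambda>i. v (\<rho> i)))"
proof -
  obtain \<phi> c where c: "range c \<subseteq> carrier R"
    and P: "\<forall>f g v e. inj (slots f g) \<longrightarrow> range v \<subseteq> carrier R \<longrightarrow> (\<forall>i. e (f i) = v i) \<longrightarrow>
       (\<forall>i. e (g i) = c i) \<longrightarrow> (P v \<longleftrightarrow> sat R e (rename_formula (slots f g) \<phi>))"
    using def_pred_reslot [OF assms(1)] by blast
  have inj: "inj (slots (\<lambda>i. 2 * \<rho> i) (\<lambda>i. Suc (2 * i)))"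
  proof (rule inj_slots)
    show "2 * \<rho> i \<noteq> Suc (2 * j)" for i j by presburger
  qed (auto intro!: injI simp: inj_eq [OF assms(2)])
  show ?thesis
  proof (rule def_predI [OF c])
    fix v :: "nat \<Rightarrow> 'a" assume v: "range v \<subseteq> carrier R"
    show "P (\<lambda>i. v (\<rho> i)) \<longleftrightarrow>
        sat R (slots v c) (rename_formula (slots (\<lambda>i. 2 * \<rho> i) (\<lambda>i. Suc (2 * i))) \<phi>)"
      by (rule P [rule_format, OF inj]) (use v in auto)
  qed
qed

text \<open>Quantification over variable 0, with the other variables shifted down.\<close>

lemma def_pred_ex:
  assumes "def_pred R (\<lambda>v. P (v 0) (\<lambda>i. v (Suc i)))"
  shows "def_pred R (\<lambda>v. \<exists>a\<in>carrier R. P a v)"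
proof -
  obtain \<phi> c where c: "range c \<subseteq> carrier R"
    and P: "\<forall>f g v e. inj (slots f g) \<longrightarrow> range v \<subseteq> carrier R \<longrightarrow> (\<forall>i. e (f i) = v i) \<longrightarrow>
       (\<forall>i. e (g i) = c i) \<longrightarrow> (P (v 0) (\<lambda>i. v (Suc i)) \<longleftrightarrow> sat R e (rename_formula (slots f g) \<phi>))"
    using def_pred_reslot [OF assms(1)] by blast
  \<comment> \<open>The bound variable is moved to a parameter slot, whose value does not matter.\<close>
  let ?f = "case_nat (Suc 0) ((*) 2)" and ?g = "\<lambda>i. Suc (2 * Suc i)"
  have inj: "inj (slots ?f ?g)"
    by (rule inj_slots) (auto simp: inj_def split: nat.splits, presburger+)
  show ?thesis
  proof (rule def_predI)
    show "range (\<lambda>i. c (i - 1)) \<subseteq> carrier R" using c by auto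
    fix v :: "nat \<Rightarrow> 'a" assume v: "range v \<subseteq> carrier R"
    have "P a v \<longleftrightarrow> sat R ((slots v (\<lambda>i. c (i - 1)))(Suc 0 := a)) (rename_formula (slots ?f ?g) \<phi>)"
      if "a \<in> carrier R" for a
    proof -
      have 1: "((slots v (\<lambda>i. c (i - 1)))(Suc 0 := a)) (?g i) = c i" for i
        using slots_odd(1) [of v "\<lambda>i. c (i - 1)" "Suc i"] by simp
      have 2: "((slots v (\<lambda>i. c (i - 1)))(Suc 0 := a)) (?f i) = case_nat a v i" for i
        by (cases i) auto
      have "range (case_nat a v) \<subseteq> carrier R"
        using v that by (auto simp: image_subset_iff split: nat.splits)
      with P inj 1 2 have "P (case_nat a v 0) (\<lambda>i. case_nat a v (Suc i)) \<longleftrightarrow>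
          sat R ((slots v (\<lambda>i. c (i - 1)))(Suc 0 := a)) (rename_formula (slots ?f ?g) \<phi>)"
        by blast
      then show ?thesis by (simp only: nat.case)
    qed
    then show "(\<exists>a\<in>carrier R. P a v) \<longleftrightarrow>
        sat R (slots v (\<lambda>i. c (i - 1))) (Ex (Suc 0) (rename_formula (slots ?f ?g) \<phi>))"
      by simp
  qed
qed

subsection \<open>Definable functions of assignments\<close>

text \<open>
  A function on assignments is definable if its graph is, with variable 0 for the value and the
  arguments shifted up.
\<close>

definition def_fun :: "('a, 'b) ring_scheme \<Rightarrow> ((nat \<Rightarrow> 'a) \<Rightarrow> 'a) \<Rightarrow> bool" where
  "def_fun R t \<longleftrightarrow> (\<forall>v. range v \<subseteq> carrier R \<longrightarrow> t v \<in> carrier R) \<and>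
     def_pred R (\<lambda>v. v 0 = t (\<lambda>i. v (Suc i)))"

lemma def_fun_closed: "def_fun R t \<Longrightarrow> range v \<subseteq> carrier R \<Longrightarrow> t v \<in> carrier R"
  by (simp add: def_fun_def)

text \<open>Substitution of a definable function for variable 0.\<close>

lemma def_pred_subst:
  assumes "def_fun R t" "def_pred R (\<lambda>v. P (v 0) (\<lambda>i. v (Suc i)))"
  shows "def_pred R (\<lambda>v. P (t v) v)"
proof (rule def_pred_cong)
  show "def_pred R (\<lambda>v. \<exists>a\<in>carrier R. a = t v \<and> P a v)"
    by (intro def_pred_ex def_pred_conj) (use assms in \<open>simp_all add: def_fun_def\<close>)
qed (use def_fun_closed [OF assms(1)] in auto)

lemma def_pred_eq:
  assumes "def_fun R s" "def_fun R t"
  shows "def_pred R (\<lambda>v. s v = t v)"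
  by (rule def_pred_subst [OF assms(1), where P = "\<lambda>a v. a = t v"]) (use assms(2) in \<open>simp add: def_fun_def\<close>)

lemma def_fun_rename:
  assumes "def_fun R t" "inj \<rho>"
  shows "def_fun R (\<lambda>v. t (\<lambda>i. v (\<rho> i)))"
proof -
  have "inj (case_nat 0 (\<lambda>i. Suc (\<rho> i)))"
    by (auto intro!: injI simp: inj_eq [OF assms(2)] split: nat.splits)
  from def_pred_rename [OF _ this, of R "\<lambda>v. v 0 = t (\<lambda>i. v (Suc i))"] assms(1)
  show ?thesis by (simp add: def_fun_def image_subset_iff)
qed

lemma def_fun_subst:
  assumes "def_fun R t" "def_fun R (\<lambda>v. g (v 0) (\<lambda>i. v (Suc i)))"
  shows "def_fun R (\<lambda>v. g (t v) v)"
  unfolding def_fun_def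
proof (intro conjI allI impI)
  fix v :: "nat \<Rightarrow> 'a" assume v: "range v \<subseteq> carrier R"
  then have "range (case_nat (t v) v) \<subseteq> carrier R"
    using def_fun_closed [OF assms(1)] by (auto simp: image_subset_iff split: nat.splits)
  from def_fun_closed [OF assms(2) this] show "g (t v) v \<in> carrier R" by simp
next
  let ?swap = "\<lambda>i::nat. if i = 0 then Suc 0 else if i = Suc 0 then 0 else i"
  have swap: "inj ?swap" by (auto intro!: injI split: if_splits)
  have "def_pred R (\<lambda>v. v 0 = g (v (Suc 0)) (\<lambda>i. v (Suc (Suc i))))"
    using assms(2) by (simp add: def_fun_def)
  from def_pred_rename [OF this swap]
  have "def_pred R (\<lambda>v. v (Suc 0) = g (v 0) (\<lambda>i. v (Suc (Suc i))))" by simp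
  then show "def_pred R (\<lambda>v. v 0 = g (t (\<lambda>i. v (Suc i))) (\<lambda>i. v (Suc i)))"
    by (intro def_pred_subst [OF def_fun_rename [OF assms(1)], where P = "\<lambda>a v. v 0 = g a (\<lambda>i. v (Suc i))"])
       auto
qed

lemma def_fun_if:
  assumes "def_pred R P" "def_fun R s" "def_fun R t"
  shows "def_fun R (\<lambda>v. if P v then s v else t v)"
  unfolding def_fun_def
proof (intro conjI allI impI)
  show "(if P v then s v else t v) \<in> carrier R" if "range v \<subseteq> carrier R" for v
    using that assms(2,3) by (simp add: def_fun_closed)
  let ?P = "\<lambda>v. P (\<lambda>i. v (Suc i))"
  have P: "def_pred R ?P"
    by (rule def_pred_rename [OF assms(1)]) simp
  have "def_pred R (\<lambda>v. (?P v \<and> v 0 = s (\<lambda>i. v (Suc i))) \<or> (\<not> ?P v \<and> v 0 = t (\<lambda>i. v (Suc i))))"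
    by (intro def_pred_disj def_pred_conj def_pred_not P)
       (use assms(2,3) in \<open>simp_all add: def_fun_def\<close>)
  then show "def_pred R (\<lambda>v. v 0 = (if ?P v then s (\<lambda>i. v (Suc i)) else t (\<lambda>i. v (Suc i))))"
    by (rule def_pred_cong) auto
qed

context ring
begin

lemma def_pred_atom:
  assumes "range c \<subseteq> carrier R"
  shows "def_pred R (\<lambda>v. eval_term R (slots v c) s = eval_term R (slots v c) t)"
  by (rule def_predI [OF assms, of _ "Eq s t"]) simp

lemma def_fun_var: "def_fun R (\<lambda>v. v i)"
proof -
  have "def_pred R (\<lambda>v. v 0 = v (Suc i))"
    using def_pred_atom [of "\<lambda>_. \<zero>" "Var (2 * 0)" "Var (2 * Suc i)"] 
    by (simp only: eval_term.simps slots_even) auto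
  then show ?thesis by (auto simp: def_fun_def)
qed

lemma def_fun_const:
  assumes "a \<in> carrier R"
  shows "def_fun R (\<lambda>_. a)"
proof -
  have "def_pred R (\<lambda>v. v 0 = a)"
    using def_pred_atom [of "\<lambda>_. a" "Var (2 * 0)" "Var (Suc (2 * 0))"] assms
    by (simp only: eval_term.simps slots_even slots_odd) auto
  then show ?thesis using assms by (auto simp: def_fun_def)
qed

lemma def_fun_add:
  assumes "def_fun R s" "def_fun R t"
  shows "def_fun R (\<lambda>v. s v \<oplus> t v)"
proof -
  have "def_pred R (\<lambda>v. v 0 = v (Suc (Suc 0)) \<oplus> v (Suc 0))"
    using def_pred_atom [of "\<lambda>_. \<zero>" "Var (2 * 0)" "Plus (Var (2 * Suc (Suc 0))) (Var (2 * Suc 0))"]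
    by (simp only: eval_term.simps slots_even) auto
  then have base: "def_fun R (\<lambda>v. v (Suc 0) \<oplus> v 0)"
    by (auto simp: def_fun_def image_subset_iff)
  have "def_fun R (\<lambda>v. v 0 \<oplus> t (\<lambda>i. v (Suc i)))"
    by (rule def_fun_subst [OF def_fun_rename [OF assms(2)], where g = "\<lambda>a v. v 0 \<oplus> a"])
       (use base in auto)
  then show ?thesis
    by (rule def_fun_subst [OF assms(1), where g = "\<lambda>a v. a \<oplus> t v"])
qed

lemma def_fun_mult:
  assumes "def_fun R s" "def_fun R t"
  shows "def_fun R (\<lambda>v. s v \<otimes> t v)"
proof -
  have "def_pred R (\<lambda>v. v 0 = v (Suc (Suc 0)) \<otimes> v (Suc 0))"
    using def_pred_atom [of "\<lambda>_. \<zero>" "Var (2 * 0)" "Times (Var (2 * Suc (Suc 0))) (Var (2 * Suc 0))"]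
    by (simp only: eval_term.simps slots_even) auto
  then have base: "def_fun R (\<lambda>v. v (Suc 0) \<otimes> v 0)"
    by (auto simp: def_fun_def image_subset_iff)
  have "def_fun R (\<lambda>v. v 0 \<otimes> t (\<lambda>i. v (Suc i)))"
    by (rule def_fun_subst [OF def_fun_rename [OF assms(2)], where g = "\<lambda>a v. v 0 \<otimes> a"])
       (use base in auto)
  then show ?thesis
    by (rule def_fun_subst [OF assms(1), where g = "\<lambda>a v. a \<otimes> t v"])
qed

lemma def_fun_pow:
  assumes "def_fun R t"
  shows "def_fun R (\<lambda>v. t v [^] (k::nat))"
  by (induction k) (simp_all add: def_fun_const def_fun_mult assms)

lemmas def_intros = def_pred_not def_pred_conj def_pred_disj def_pred_ex def_pred_eq
  def_fun_if def_fun_var def_fun_const def_fun_add def_fun_mult def_fun_pow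

lemma def_pred_True: "def_pred R (\<lambda>_. True)"
  using def_pred_eq [OF def_fun_var def_fun_var, of 0 0] by simp

end

section \<open>Definable sets and definable equivalence\<close>

text \<open>Agreement with the notion of a definable set of tuples.\<close>

lemma definable_iff_def_pred:
  assumes "ring R"
  shows "definable R m A \<longleftrightarrow> A \<subseteq> tuples R m \<and> def_pred R (\<lambda>v. map v [0..<m] \<in> A)"
proof
  assume "definable R m A"
  then obtain \<phi> e where e: "range e \<subseteq> carrier R"
    and A: "A = {xs \<in> tuples R m. sat R (\<lambda>i. if i < m then xs ! i else e i) \<phi>}"
    unfolding definable_def by blast
  let ?\<rho> = "\<lambda>i::nat. if i < m then 2 * i else Suc (2 * i)"
  have inj: "inj ?\<rho>" by (auto simp: inj_def)
  have "def_pred R (\<lambda>v. map v [0..<m] \<in> A)"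
  proof (rule def_predI [OF e])
    fix v :: "nat \<Rightarrow> 'a" assume v: "range v \<subseteq> carrier R"
    have "(\<lambda>i. slots v e (?\<rho> i)) = (\<lambda>i. if i < m then map v [0..<m] ! i else e i)"
      by auto
    moreover have "map v [0..<m] \<in> tuples R m" using v by (auto simp: tuples_def)
    ultimately show "map v [0..<m] \<in> A \<longleftrightarrow> sat R (slots v e) (rename_formula ?\<rho> \<phi>)"
      unfolding A by (simp add: sat_rename_formula [OF inj])
  qed
  then show "A \<subseteq> tuples R m \<and> def_pred R (\<lambda>v. map v [0..<m] \<in> A)"
    using A by blast
next
  interpret ring R by fact
  assume *: "A \<subseteq> tuples R m \<and> def_pred R (\<lambda>v. map v [0..<m] \<in> A)"
  obtain \<phi> c where c: "range c \<subseteq> carrier R"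
    and P: "\<forall>f g v e. inj (slots f g) \<longrightarrow> range v \<subseteq> carrier R \<longrightarrow> (\<forall>i. e (f i) = v i) \<longrightarrow>
       (\<forall>i. e (g i) = c i) \<longrightarrow> (map v [0..<m] \<in> A \<longleftrightarrow> sat R e (rename_formula (slots f g) \<phi>))"
    using def_pred_reslot [OF conjunct2 [OF *]] by blast
  let ?f = "\<lambda>i::nat. if i < m then i else m + 2 * i" and ?g = "\<lambda>i. Suc (m + 2 * i)"
  let ?\<rho> = "slots ?f ?g"
  let ?e = "\<lambda>i. slots (\<lambda>_. \<zero>\<^bsub>R\<^esub>) c (i - m)"
  have inj: "inj (slots ?f ?g)"
  proof (rule inj_slots)
    show "?f i \<noteq> ?g j" for i j by presburger
  qed (auto simp: inj_def)
  have "xs \<in> A \<longleftrightarrow> sat R (\<lambda>i. if i < m then xs ! i else ?e i) (rename_formula ?\<rho> \<phi>)"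
    if "xs \<in> tuples R m" for xs
  proof -
    let ?v = "\<lambda>i. if i < m then xs ! i else \<zero>\<^bsub>R\<^esub>"
    have xs: "map ?v [0..<m] = xs" using that by (auto simp: tuples_def intro: nth_equalityI)
    have "range ?v \<subseteq> carrier R" using that by (auto simp: tuples_def)
    from P [rule_format, OF inj this, of "\<lambda>i. if i < m then xs ! i else ?e i"] show ?thesis
      unfolding xs by auto
  qed
  then have "A = {xs \<in> tuples R m. sat R (\<lambda>i. if i < m then xs ! i else ?e i) (rename_formula ?\<rho> \<phi>)}"
    using * by blast
  moreover have "range ?e \<subseteq> carrier R" using c by (auto simp: slots_def)
  ultimately show "definable R m A" unfolding definable_def by blast
qed


lemma map_upt_add: "map v [0..<m + n] = map v [0..<m] @ map (\<lambda>i. v (m + i)) [0..<n]"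
proof -
  have "map v [m..<m + n] = map (\<lambda>i. v (m + i)) [0..<n]"
    by (rule nth_equalityI) auto
  then show ?thesis by (simp add: upt_add_eq_append [of 0 m n])
qed

lemma def_pred_map_eq:
  assumes "ring R"
  shows "def_pred R (\<lambda>v. map (\<lambda>i. v (f i)) [0..<m] = map (\<lambda>i. v (g i)) [0..<m])"
proof -
  interpret ring R by fact
  show ?thesis
  proof (induction m)
    case (Suc m)
    show ?case
      by (rule def_pred_cong [OF def_pred_conj [OF Suc def_pred_eq [OF def_fun_var def_fun_var]],
            of "f m" "g m"]) simp
  qed (simp add: def_pred_True)
qed

text \<open>A criterion for the definability of a graph, in terms of assignments.\<close>

lemma definable_graph:
  assumes "ring R" "A \<subseteq> tuples R m" "\<And>x. x \<in> A \<Longrightarrow> f x \<in> tuples R n"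
    and "def_pred R (\<lambda>v. map v [0..<m] \<in> A \<and> map (\<lambda>i. v (m + i)) [0..<n] = f (map v [0..<m]))"
  shows "definable R (m + n) {x @ f x |x. x \<in> A}"
  unfolding definable_iff_def_pred [OF assms(1)]
proof
  show "{x @ f x |x. x \<in> A} \<subseteq> tuples R (m + n)"
    using assms(2,3) by (fastforce simp: tuples_def)
  have "map v [0..<m + n] \<in> {x @ f x |x. x \<in> A} \<longleftrightarrow>
      map v [0..<m] \<in> A \<and> map (\<lambda>i. v (m + i)) [0..<n] = f (map v [0..<m])" for v
  proof -
    have "length x = m" if "x \<in> A" for x using that assms(2) by (auto simp: tuples_def)
    moreover have "length (map v [0..<m]) = m" by simp
    ultimately show ?thesis unfolding map_upt_add mem_Collect_eq by (metis append_eq_append_conv)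
  qed
  with assms(4) show "def_pred R (\<lambda>v. map v [0..<m + n] \<in> {x @ f x |x. x \<in> A})"
    by (simp only:)
qed

text \<open>
  Subsets of the line, that is, of the ring itself, are definably equivalent if there is a definable
  bijection between them. Definability of the two sets follows from that of the graph.
\<close>

definition def_equiv :: "('a, 'b) ring_scheme \<Rightarrow> 'a set \<Rightarrow> 'a set \<Rightarrow> bool" where
  "def_equiv R A B \<longleftrightarrow> A \<subseteq> carrier R \<and> B \<subseteq> carrier R \<and>
     (\<exists>f. bij_betw f A B \<and> def_pred R (\<lambda>v. v 0 \<in> A \<and> v (Suc 0) = f (v 0)))"

lemma inj_swap: "inj (\<lambda>i::nat. if i = 0 then Suc 0 else if i = Suc 0 then 0 else i)"
  by (auto intro!: injI split: if_splits)

lemma def_pred_swap: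
  assumes "def_pred R (\<lambda>v. P (v 0) (v (Suc 0)))"
  shows "def_pred R (\<lambda>v. P (v (Suc 0)) (v 0))"
  using def_pred_rename [OF assms inj_swap] by simp

lemma def_equiv_sym:
  assumes "def_equiv R A B"
  shows "def_equiv R B A"
proof -
  obtain f where AB: "A \<subseteq> carrier R" "B \<subseteq> carrier R" and f: "bij_betw f A B"
    and gr: "def_pred R (\<lambda>v. v 0 \<in> A \<and> v (Suc 0) = f (v 0))"
    using assms unfolding def_equiv_def by blast
  have "def_pred R (\<lambda>v. v 0 \<in> B \<and> v (Suc 0) = inv_into A f (v 0))"
  proof (rule def_pred_cong)
    show "def_pred R (\<lambda>v. v (Suc 0) \<in> A \<and> v 0 = f (v (Suc 0)))"
      using def_pred_swap [of R "\<lambda>x y. x \<in> A \<and> y = f x"] gr by simp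
    fix v :: "nat \<Rightarrow> 'a"
    show "(v (Suc 0) \<in> A \<and> v 0 = f (v (Suc 0))) \<longleftrightarrow> (v 0 \<in> B \<and> v (Suc 0) = inv_into A f (v 0))"
      using bij_betw_inv_into_left [OF f] bij_betw_inv_into_right [OF f]
        bij_betwE [OF f] bij_betwE [OF bij_betw_inv_into [OF f]] by auto
  qed
  then show ?thesis using AB bij_betw_inv_into [OF f] unfolding def_equiv_def by blast
qed

lemma def_equiv_Un:
  assumes "def_equiv R A A'" "def_equiv R B B'" "A \<inter> B = {}" "A' \<inter> B' = {}"
  shows "def_equiv R (A \<union> B) (A' \<union> B')"
proof -
  obtain f where A: "A \<subseteq> carrier R" "A' \<subseteq> carrier R" and f: "bij_betw f A A'"
    and gr_f: "def_pred R (\<lambda>v. v 0 \<in> A \<and> v (Suc 0) = f (v 0))"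
    using assms(1) unfolding def_equiv_def by blast
  obtain g where B: "B \<subseteq> carrier R" "B' \<subseteq> carrier R" and g: "bij_betw g B B'"
    and gr_g: "def_pred R (\<lambda>v. v 0 \<in> B \<and> v (Suc 0) = g (v 0))"
    using assms(2) unfolding def_equiv_def by blast
  let ?h = "\<lambda>x. if x \<in> A then f x else g x"
  have "bij_betw ?h A A'" using f by (rule bij_betw_cong [THEN iffD1, rotated]) simp
  moreover have "bij_betw ?h B B'"
    using g by (rule bij_betw_cong [THEN iffD1, rotated]) (use assms(3) in auto)
  ultimately have "bij_betw ?h (A \<union> B) (A' \<union> B')"
    using assms(4) by (rule bij_betw_combine)
  moreover have "def_pred R (\<lambda>v. v 0 \<in> A \<union> B \<and> v (Suc 0) = ?h (v 0))"
    by (rule def_pred_cong [OF def_pred_disj [OF gr_f gr_g]]) (use assms(3) in auto)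
  ultimately show ?thesis using A B unfolding def_equiv_def by blast
qed

context ring
begin

lemma def_equiv_dom:
  assumes "def_equiv R A B"
  shows "def_pred R (\<lambda>v. v 0 \<in> A)"
proof -
  obtain f where AB: "A \<subseteq> carrier R" "B \<subseteq> carrier R" and f: "bij_betw f A B"
    and gr: "def_pred R (\<lambda>v. v 0 \<in> A \<and> v (Suc 0) = f (v 0))"
    using assms unfolding def_equiv_def by blast
  have "def_pred R (\<lambda>v. \<exists>b\<in>carrier R. v 0 \<in> A \<and> b = f (v 0))"
    by (rule def_pred_ex) (rule def_pred_swap [of R "\<lambda>x y. x \<in> A \<and> y = f x", OF gr])
  then show ?thesis
    by (rule def_pred_cong) (use bij_betwE [OF f] AB in auto)
qed

lemma def_equiv_refl:
  assumes "A \<subseteq> carrier R" "def_pred R (\<lambda>v. v 0 \<in> A)"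
  shows "def_equiv R A A"
proof -
  have "def_pred R (\<lambda>v. v 0 \<in> A \<and> v (Suc 0) = id (v 0))"
    unfolding id_apply by (intro def_intros assms)
  then show ?thesis unfolding def_equiv_def using assms(1) bij_betw_id by blast
qed

lemma def_equiv_trans:
  assumes "def_equiv R A B" "def_equiv R B C"
  shows "def_equiv R A C"
proof -
  obtain f where A: "A \<subseteq> carrier R" "B \<subseteq> carrier R" and f: "bij_betw f A B"
    and gr_f: "def_pred R (\<lambda>v. v 0 \<in> A \<and> v (Suc 0) = f (v 0))"
    using assms(1) unfolding def_equiv_def by blast
  obtain g where B: "C \<subseteq> carrier R" and g: "bij_betw g B C"
    and gr_g: "def_pred R (\<lambda>v. v 0 \<in> B \<and> v (Suc 0) = g (v 0))"
    using assms(2) unfolding def_equiv_def by blast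
  have "def_pred R (\<lambda>v. \<exists>b\<in>carrier R. (v 0 \<in> A \<and> b = f (v 0)) \<and> (b \<in> B \<and> v (Suc 0) = g b))"
  proof (rule def_pred_ex, rule def_pred_conj)
    show "def_pred R (\<lambda>v. v (Suc 0) \<in> A \<and> v 0 = f (v (Suc 0)))"
      by (rule def_pred_swap [of R "\<lambda>x y. x \<in> A \<and> y = f x", OF gr_f])
    have "inj (\<lambda>i. if i = 0 then 0 else Suc i)" by (auto intro!: injI split: if_splits)
    from def_pred_rename [OF gr_g this]
    show "def_pred R (\<lambda>v. v 0 \<in> B \<and> v (Suc (Suc 0)) = g (v 0))" by simp
  qed
  then have "def_pred R (\<lambda>v. v 0 \<in> A \<and> v (Suc 0) = (g \<circ> f) (v 0))"
    by (rule def_pred_cong) (use bij_betwE [OF f] A in auto)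
  then show ?thesis
    unfolding def_equiv_def using bij_betw_trans [OF f g] A B by blast
qed

lemma def_equiv_image:
  assumes "S \<subseteq> carrier R" "def_pred R (\<lambda>v. v 0 \<in> S)" "def_fun R (\<lambda>v. f (v 0))" "inj_on f S"
  shows "def_equiv R S (f ` S)"
proof -
  have "f x \<in> carrier R" if "x \<in> S" for x
    using def_fun_closed [OF assms(3), of "\<lambda>_. x"] assms(1) that by auto
  moreover have "def_pred R (\<lambda>v. v 0 \<in> S \<and> v (Suc 0) = f (v 0))"
    by (intro def_intros assms)
  ultimately show ?thesis
    unfolding def_equiv_def using assms(1,4) by (auto simp: bij_betw_def)
qed

text \<open>
  Two injective definable maps on a square \<open>S \<times> S\<close> have definably equivalent images. Bijections
  between subsets of the plane thereby become bijections between subsets of the line.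
\<close>

lemma def_equiv_image2:
  assumes "S \<subseteq> carrier R" "def_pred R (\<lambda>v. v 0 \<in> S)"
    and f: "def_fun R (\<lambda>v. f (v 0) (v (Suc 0)))" "inj_on (\<lambda>(x, y). f x y) (S \<times> S)"
    and g: "def_fun R (\<lambda>v. g (v 0) (v (Suc 0)))" "inj_on (\<lambda>(x, y). g x y) (S \<times> S)"
  shows "def_equiv R ((\<lambda>(x, y). f x y) ` (S \<times> S)) ((\<lambda>(x, y). g x y) ` (S \<times> S))"
    (is "def_equiv R (?f ` _) (?g ` _)")
proof -
  let ?h = "?g \<circ> inv_into (S \<times> S) ?f"
  have bij: "bij_betw ?h (?f ` (S \<times> S)) (?g ` (S \<times> S))"
    using f(2) g(2) by (intro bij_betw_trans [OF bij_betw_inv_into]) (auto intro: inj_on_imp_bij_betw)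
  have cl: "h x y \<in> carrier R" if "def_fun R (\<lambda>v. h (v 0) (v (Suc 0)))" "x \<in> S" "y \<in> S" for h x y
  proof -
    have "range (case_nat x (\<lambda>_. y)) \<subseteq> carrier R"
      using that assms(1) by (auto simp: image_subset_iff split: nat.splits)
    from def_fun_closed [OF that(1) this] show ?thesis by simp
  qed
  have ren: "def_pred R (\<lambda>v. v i = h (v (Suc 0)) (v 0))"
    if "def_fun R (\<lambda>v. h (v 0) (v (Suc 0)))" for h i
    by (rule def_pred_eq [OF def_fun_var]) (use def_fun_rename [OF that inj_swap] in simp)
  have S: "def_pred R (\<lambda>v. v 0 \<in> S)" "def_pred R (\<lambda>v. v (Suc 0) \<in> S)"
    using assms(2) def_pred_rename [OF assms(2), of Suc] by simp_all
  have "def_pred R (\<lambda>v. \<exists>x\<in>carrier R. \<exists>y\<in>carrier R.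
      x \<in> S \<and> y \<in> S \<and> v 0 = f x y \<and> v (Suc 0) = g x y)"
    by (intro def_intros S ren f(1) g(1))
  then have "def_pred R (\<lambda>v. v 0 \<in> ?f ` (S \<times> S) \<and> v (Suc 0) = ?h (v 0))"
  proof (rule def_pred_cong)
    fix v :: "nat \<Rightarrow> 'a"
    have "?h (f x y) = g x y" if "x \<in> S" "y \<in> S" for x y
      using inv_into_f_f [OF f(2), of "(x, y)"] that by simp
    then show "(\<exists>x\<in>carrier R. \<exists>y\<in>carrier R. x \<in> S \<and> y \<in> S \<and> v 0 = f x y \<and> v (Suc 0) = g x y) \<longleftrightarrow>
        (v 0 \<in> ?f ` (S \<times> S) \<and> v (Suc 0) = ?h (v 0))"
      using assms(1) by (auto simp del: comp_apply) blast+
  qed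
  then show ?thesis
    unfolding def_equiv_def using bij cl [OF f(1)] cl [OF g(1)] by auto
qed

section \<open>Vanishing of the Grothendieck ring\<close>

lemma cart_prod_points: "cart_prod (points A) C = {x # xs |x xs. x \<in> A \<and> xs \<in> C}"
  unfolding cart_prod_def points_def by (auto, metis append_Cons append_Nil)

lemma definable_cart_prod_points:
  assumes "A \<subseteq> carrier R" "def_pred R (\<lambda>v. v 0 \<in> A)" "definable R m C"
  shows "definable R (Suc m) (cart_prod (points A) C)"
proof -
  have C: "C \<subseteq> tuples R m" "def_pred R (\<lambda>v. map v [0..<m] \<in> C)"
    using assms(3) by (simp_all add: definable_iff_def_pred ring_axioms)
  have "def_pred R (\<lambda>v. v 0 \<in> A \<and> map (\<lambda>i. v (Suc i)) [0..<m] \<in> C)"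
    using def_pred_rename [OF C(2), of Suc] assms(2) by (intro def_pred_conj) simp_all
  moreover have "map v [0..<Suc m] \<in> cart_prod (points A) C \<longleftrightarrow>
      v 0 \<in> A \<and> map (\<lambda>i. v (Suc i)) [0..<m] \<in> C" for v
    unfolding cart_prod_points map_upt_Suc by auto
  ultimately have "def_pred R (\<lambda>v. map v [0..<Suc m] \<in> cart_prod (points A) C)" by (simp only:)
  moreover have "cart_prod (points A) C \<subseteq> tuples R (Suc m)"
    using assms(1) C(1) by (fastforce simp: cart_prod_points tuples_def)
  ultimately show ?thesis by (simp only: definable_iff_def_pred ring_axioms)
qed

lemma definable_bij_cart_prod:
  assumes "def_equiv R A B" "definable R m C"
  shows "\<exists>f. definable_bij R f (cart_prod (points A) C) (cart_prod (points B) C)"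
proof -
  obtain f where AB: "A \<subseteq> carrier R" "B \<subseteq> carrier R" and f: "bij_betw f A B"
    and gr: "def_pred R (\<lambda>v. v 0 \<in> A \<and> v (Suc 0) = f (v 0))"
    using assms(1) unfolding def_equiv_def by blast
  have C: "C \<subseteq> tuples R m" "def_pred R (\<lambda>v. map v [0..<m] \<in> C)"
    using assms(2) by (simp_all add: definable_iff_def_pred ring_axioms)
  have dA: "definable R (Suc m) (cart_prod (points A) C)"
    and dB: "definable R (Suc m) (cart_prod (points B) C)"
    using AB assms(2) def_equiv_dom [OF assms(1)] def_equiv_dom [OF def_equiv_sym [OF assms(1)]]
    by (auto intro: definable_cart_prod_points)
  let ?F = "\<lambda>xs. f (hd xs) # tl xs"
  have bij: "bij_betw ?F (cart_prod (points A) C) (cart_prod (points B) C)"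
    by (rule bij_betw_byWitness [where f' = "\<lambda>xs. inv_into A f (hd xs) # tl xs"])
      (use f in \<open>auto simp: cart_prod_points bij_betw_inv_into_left bij_betw_inv_into_right
         dest: bij_betwE bij_betwE [OF bij_betw_inv_into]\<close>)
  have "inj (\<lambda>i. if i = 0 then 0 else m + i)" by (auto intro!: injI split: if_splits)
  from def_pred_rename [OF gr this]
  have gr': "def_pred R (\<lambda>v. v 0 \<in> A \<and> v (Suc m) = f (v 0))" by simp
  have "def_pred R (\<lambda>v. map (\<lambda>i. v (Suc i)) [0..<m] \<in> C)"
    using def_pred_rename [OF C(2), of Suc] by simp
  note def_pred_conj [OF gr' def_pred_conj [OF this
      def_pred_map_eq [OF ring_axioms, of "\<lambda>i. Suc (Suc m + i)" m Suc]]]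
  moreover have "(map v [0..<Suc m] \<in> cart_prod (points A) C \<and>
        map (\<lambda>i. v (Suc m + i)) [0..<Suc m] = ?F (map v [0..<Suc m])) \<longleftrightarrow>
      ((v 0 \<in> A \<and> v (Suc m) = f (v 0)) \<and> map (\<lambda>i. v (Suc i)) [0..<m] \<in> C \<and>
      map (\<lambda>i. v (Suc (Suc m + i))) [0..<m] = map (\<lambda>i. v (Suc i)) [0..<m])" for v
    unfolding cart_prod_points map_upt_Suc by auto
  ultimately have "def_pred R (\<lambda>v. map v [0..<Suc m] \<in> cart_prod (points A) C \<and>
        map (\<lambda>i. v (Suc m + i)) [0..<Suc m] = ?F (map v [0..<Suc m]))"
    by (simp only:)
  moreover have "x \<in> tuples R (Suc m)" if "x \<in> cart_prod (points A) C" for x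
    using dA that by (auto simp: definable_iff_def_pred ring_axioms)
  moreover have "?F x \<in> tuples R (Suc m)" if "x \<in> cart_prod (points A) C" for x
    using dB bij_betwE [OF bij] that by (auto simp: definable_iff_def_pred ring_axioms)
  ultimately have "definable R (Suc m + Suc m) {x @ ?F x |x. x \<in> cart_prod (points A) C}"
    by (intro definable_graph ring_axioms) auto
  then show ?thesis unfolding definable_bij_def using bij dA dB by blast
qed

lemma definable_bij_zero_cart_prod:
  assumes "definable R m C" "m > 0"
  shows "definable_bij R tl (cart_prod (points {\<zero>}) C) C"
proof -
  have C: "C \<subseteq> tuples R m" "def_pred R (\<lambda>v. map v [0..<m] \<in> C)"
    using assms(1) by (simp_all add: definable_iff_def_pred ring_axioms)
  have d: "definable R (Suc m) (cart_prod (points {\<zero>}) C)"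
    by (rule definable_cart_prod_points)
       (auto intro!: assms(1) def_pred_eq def_fun_var def_fun_const)
  have bij: "bij_betw tl (cart_prod (points {\<zero>}) C) C"
    by (rule bij_betw_byWitness [where f' = "(#) \<zero>"]) (auto simp: cart_prod_points)
  have "def_pred R (\<lambda>v. v 0 = \<zero> \<and> map (\<lambda>i. v (Suc i)) [0..<m] \<in> C \<and>
      map (\<lambda>i. v (Suc m + i)) [0..<m] = map (\<lambda>i. v (Suc i)) [0..<m])"
  proof (intro def_intros def_pred_map_eq [OF ring_axioms] zero_closed)
    show "def_pred R (\<lambda>v. map (\<lambda>i. v (Suc i)) [0..<m] \<in> C)"
      using def_pred_rename [OF C(2), of Suc] by simp
  qed
  moreover have "(map v [0..<Suc m] \<in> cart_prod (points {\<zero>}) C \<and>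
        map (\<lambda>i. v (Suc m + i)) [0..<m] = tl (map v [0..<Suc m])) \<longleftrightarrow>
      (v 0 = \<zero> \<and> map (\<lambda>i. v (Suc i)) [0..<m] \<in> C \<and>
      map (\<lambda>i. v (Suc m + i)) [0..<m] = map (\<lambda>i. v (Suc i)) [0..<m])" for v
    unfolding cart_prod_points map_upt_Suc by auto
  ultimately have "def_pred R (\<lambda>v. map v [0..<Suc m] \<in> cart_prod (points {\<zero>}) C \<and>
        map (\<lambda>i. v (Suc m + i)) [0..<m] = tl (map v [0..<Suc m]))"
    by (simp only:)
  moreover have "x \<in> tuples R (Suc m)" if "x \<in> cart_prod (points {\<zero>}) C" for x
    using d that by (auto simp: definable_iff_def_pred ring_axioms)
  moreover have "tl x \<in> tuples R m" if "x \<in> cart_prod (points {\<zero>}) C" for x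
    using C(1) that by (auto simp: cart_prod_points)
  ultimately have "definable R (Suc m + m) {x @ tl x |x. x \<in> cart_prod (points {\<zero>}) C}"
    by (intro definable_graph ring_axioms) auto
  then show ?thesis unfolding definable_bij_def using bij d assms by blast
qed

lemma definable_bij_points:
  assumes "def_equiv R A B"
  shows "\<exists>f. definable_bij R f (points A) (points B)"
proof -
  have "definable R 0 {[]}"
    by (auto simp: definable_iff_def_pred ring_axioms tuples_def def_pred_True)
  moreover have "cart_prod (points S) {[]} = points S" for S :: "'a set"
    unfolding cart_prod_points by (auto simp: points_def)
  ultimately show ?thesis using definable_bij_cart_prod [OF assms] by metis
qed

lemma K0_relators_bij: "definable_bij R f A B \<Longrightarrow> frag_of A - frag_of B \<in> K0_relators R"
  unfolding K0_relators_def by blast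

lemma K0_relators_Un:
  "\<lbrakk>m > 0; definable R m A; definable R m B; definable R m C; A = B \<union> C; B \<inter> C = {}\<rbrakk>
    \<Longrightarrow> frag_of A - (frag_of B + frag_of C) \<in> K0_relators R"
  unfolding K0_relators_def by blast

text \<open>
  Multiply the bijection by any definable set \<open>C\<close>: the class of the product of \<open>C\<close> with a point,
  which is that of \<open>C\<close>, is the difference of two equal classes. So every generator is a
  combination of relators.
\<close>

lemma K0_trivial:
  assumes "def_equiv R (carrier R) (carrier R - {\<zero>})"
  shows "carrier (K0 R) = {\<zero>\<^bsub>K0 R\<^esub>}"
proof -
  let ?S = "definable_sets R"
  let ?G = "free_Abelian_group ?S"
  let ?H = "generate ?G (K0_relators R)"
  have rel: "K0_relators R \<subseteq> carrier ?G"
  proof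
    fix x assume "x \<in> K0_relators R"
    then consider (bij) A B f where "x = frag_of A - frag_of B" "definable_bij R f A B"
      | (un) m A B C where "x = frag_of A - (frag_of B + frag_of C)" "m > 0"
          "definable R m A" "definable R m B" "definable R m C"
      unfolding K0_relators_def by blast
    then show "x \<in> carrier ?G"
    proof cases
      case bij
      then have "A \<in> ?S" "B \<in> ?S" by (auto simp: definable_bij_def definable_sets_def)
      then show ?thesis using keys_diff [of "frag_of A" "frag_of B"] bij(1) by auto
    next
      case un
      then have "A \<in> ?S" "B \<in> ?S" "C \<in> ?S" by (auto simp: definable_sets_def)
      then show ?thesis
        using keys_diff [of "frag_of A" "frag_of B + frag_of C"]
          keys_add [of "frag_of B" "frag_of C"] un(1) by fastforce
    qed
  qed
  interpret G: group ?G by simp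
  interpret H: subgroup ?H ?G by (rule G.generate_is_subgroup [OF rel])
  have minus: "x - y \<in> ?H" if "x \<in> ?H" "y \<in> ?H" for x y
  proof -
    have "x \<otimes>\<^bsub>?G\<^esub> inv\<^bsub>?G\<^esub> y \<in> ?H" using that by blast
    moreover have "Poly_Mapping.keys y \<subseteq> ?S" using H.mem_carrier [OF that(2)] by simp
    ultimately show ?thesis by simp
  qed
  have gen: "frag_of C \<in> ?H" if C: "C \<in> ?S" for C
  proof -
    obtain m where m: "m > 0" "definable R m C"
      using C unfolding definable_sets_def by blast
    let ?A = "cart_prod (points (carrier R)) C" and ?B = "cart_prod (points (carrier R - {\<zero>})) C"
    let ?Z = "cart_prod (points {\<zero>}) C"
    have dB: "def_pred R (\<lambda>v. v 0 \<in> carrier R - {\<zero>})" and dA: "def_pred R (\<lambda>v. v 0 \<in> carrier R)"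
      using def_equiv_dom [OF assms] def_equiv_dom [OF def_equiv_sym [OF assms]] by simp_all
    have Z: "def_pred R (\<lambda>v. v 0 \<in> {\<zero>})"
      using def_pred_eq [OF def_fun_var def_fun_const [OF zero_closed], of 0] by simp
    obtain f where "definable_bij R f ?A ?B"
      using definable_bij_cart_prod [OF assms m(2)] ..
    then have 1: "frag_of ?A - frag_of ?B \<in> ?H"
      by (intro generate.incl K0_relators_bij)
    have 2: "frag_of ?A - (frag_of ?B + frag_of ?Z) \<in> ?H"
    proof (intro generate.incl K0_relators_Un)
      show "definable R (Suc m) ?A" by (rule definable_cart_prod_points [OF subset_refl dA m(2)])
      show "definable R (Suc m) ?B" by (rule definable_cart_prod_points [OF Diff_subset dB m(2)])
      show "definable R (Suc m) ?Z" by (rule definable_cart_prod_points [OF _ Z m(2)]) simp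
      show "?A = ?B \<union> ?Z" "?B \<inter> ?Z = {}" by (auto simp: cart_prod_points)
    qed simp
    have 3: "frag_of ?Z - frag_of C \<in> ?H"
      by (rule generate.incl [OF K0_relators_bij [OF definable_bij_zero_cart_prod [OF m(2,1)]]])
    from minus [OF minus [OF 1 2] 3] show ?thesis by simp
  qed
  have "x \<in> ?H" if "Poly_Mapping.keys x \<subseteq> ?S" for x
    using that
  proof (rule free_Abelian_group_induct)
    show "0 \<in> ?H" using H.one_closed by simp
  qed (use minus gen in auto)
  then have H: "?H = carrier (K0_free R)"
    using H.subset by (auto simp: K0_free_def)
  have coset: "?H +>\<^bsub>K0_free R\<^esub> a = ?H" if "a \<in> carrier (K0_free R)" for a
  proof -
    have "?H #>\<^bsub>?G\<^esub> a = ?H" using that H G.coset_join2 [OF _ H.subgroup_axioms, of a]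
      by (simp add: K0_free_def)
    then show ?thesis
      by (simp add: a_r_coset_def r_coset_def K0_free_def)
  qed
  have "\<zero>\<^bsub>K0_free R\<^esub> \<in> carrier (K0_free R)" by (simp add: K0_free_def)
  with coset show ?thesis
    unfolding K0_def FactRing_def by (auto simp: A_RCOSETS_def' )
qed

end

section \<open>Powers in characteristic p\<close>

context cring
begin

lemma binomial_expansion:
  assumes "a \<in> carrier R" "b \<in> carrier R"
  shows "(a \<oplus> b) [^] (n::nat) =
    (\<Oplus>k\<in>{..n}. add_pow R (n choose k) (a [^] k \<otimes> b [^] (n - k)))"
proof (induction n)
  case 0
  show ?case using assms by simp
next
  case (Suc n)
  define T where "T n k = add_pow R (n choose k) (a [^] k \<otimes> b [^] (n - k))" for n k :: nat
  have T: "T n k \<in> carrier R" for n k using assms by (simp add: T_def)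
  have pascal: "T (Suc n) (Suc k) = a \<otimes> T n k \<oplus> b \<otimes> T n (Suc k)" if "k \<le> n" for k
  proof -
    have "a \<otimes> T n k = add_pow R (n choose k) (a [^] Suc k \<otimes> b [^] (n - k))"
      unfolding T_def using assms by (subst add_pow_rdistr) (simp_all add: m_ac nat_pow_Suc)
    moreover have "b \<otimes> T n (Suc k) = add_pow R (n choose Suc k) (a [^] Suc k \<otimes> b [^] (n - k))"
    proof (cases "k < n")
      case True
      then have "b [^] (n - k) = b [^] (n - Suc k) \<otimes> b" by (simp flip: nat_pow_Suc add: Suc_diff_Suc)
      then show ?thesis
        unfolding T_def using assms by (subst add_pow_rdistr) (simp_all add: m_ac)
    next
      case False
      with that show ?thesis unfolding T_def using assms by (simp add: binomial_eq_0)
    qed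
    ultimately show ?thesis
      unfolding T_def using assms by (simp add: add.nat_pow_mult)
  qed
  have "T (Suc n) 0 = b \<otimes> T n 0"
    unfolding T_def using assms by (simp add: m_comm)
  moreover have "(\<Oplus>k\<in>{..n}. T (Suc n) (Suc k)) = (\<Oplus>k\<in>{..n}. a \<otimes> T n k \<oplus> b \<otimes> T n (Suc k))"
    by (rule finsum_cong') (use T assms in \<open>auto simp: pascal\<close>)
  ultimately have "(\<Oplus>k\<in>{..Suc n}. T (Suc n) k) = (\<Oplus>k\<in>{..n}. a \<otimes> T n k \<oplus> b \<otimes> T n (Suc k)) \<oplus> b \<otimes> T n 0"
    using T by (subst finsum_Suc2) auto
  also have "\<dots> = a \<otimes> (\<Oplus>k\<in>{..n}. T n k) \<oplus> b \<otimes> ((\<Oplus>k\<in>{..n}. T n (Suc k)) \<oplus> T n 0)"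
    using T assms by (simp add: finsum_addf finsum_rdistr r_distr a_ac)
  also have "(\<Oplus>k\<in>{..n}. T n (Suc k)) \<oplus> T n 0 = (\<Oplus>k\<in>{..Suc n}. T n k)"
    using T by (subst finsum_Suc2) auto
  also have "\<dots> = (\<Oplus>k\<in>{..n}. T n k)"
  proof -
    have "T n (Suc n) = \<zero>" by (simp add: T_def binomial_eq_0)
    then show ?thesis using T by (subst finsum_Suc) auto
  qed
  also have "a \<otimes> (\<Oplus>k\<in>{..n}. T n k) \<oplus> b \<otimes> (\<Oplus>k\<in>{..n}. T n k) = (a \<oplus> b) [^] Suc n"
    using Suc T assms by (simp add: T_def m_comm l_distr)
  finally show ?case unfolding T_def by simp
qed

lemma add_pow_char:
  assumes "add_pow R (p::nat) \<one> = \<zero>" "p dvd k" "x \<in> carrier R"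
  shows "add_pow R k x = \<zero>"
proof -
  obtain q where k: "k = p * q" using assms(2) by (elim dvdE)
  have "add_pow R p x = add_pow R p \<one> \<otimes> x" using assms(3) by (subst add_pow_ldistr) auto
  then have "add_pow R p x = \<zero>" using assms(1,3) by simp
  then show ?thesis unfolding k using assms(3) by (simp flip: add.nat_pow_pow)
qed

lemma frobenius_add:
  assumes "Factorial_Ring.prime p" "add_pow R p \<one> = \<zero>" "a \<in> carrier R" "b \<in> carrier R"
  shows "(a \<oplus> b) [^] (p::nat) = a [^] p \<oplus> b [^] p"
proof -
  define T where "T k = add_pow R (p choose k) (a [^] k \<otimes> b [^] (p - k))" for k :: nat
  have T: "T k \<in> carrier R" for k using assms by (simp add: T_def)
  have p0: "p > 0" using assms(1) by (rule prime_gt_0_nat)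
  have "T k = \<zero>" if "k \<in> {..p} - {0, p}" for k
    unfolding T_def
  proof (rule add_pow_char [OF assms(2)])
    show "p dvd p choose k" using that assms(1) by (intro dvd_choose_prime) auto
  qed (use assms in auto)
  then have "(\<Oplus>k\<in>{..p}. T k) = (\<Oplus>k\<in>{0, p}. T k)"
    using T by (intro add.finprod_mono_neutral_cong_right) auto
  also have "\<dots> = b [^] p \<oplus> a [^] p"
    using T p0 assms by (simp add: T_def)
  finally show ?thesis
    using binomial_expansion [OF assms(3,4), of p] assms(3,4) by (simp add: T_def a_comm)
qed

lemma frobenius_power_add:
  fixes p e :: nat
  assumes "Factorial_Ring.prime p" "add_pow R p \<one> = \<zero>" "a \<in> carrier R" "b \<in> carrier R"
  shows "(a \<oplus> b) [^] (p ^ e) = a [^] (p ^ e) \<oplus> b [^] (p ^ e)"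
proof (induction e)
  case (Suc e)
  have "(a \<oplus> b) [^] (p ^ Suc e) = ((a \<oplus> b) [^] (p ^ e)) [^] p"
    using assms by (simp add: nat_pow_pow power_Suc2 del: power_Suc)
  also have "\<dots> = (a [^] (p ^ e)) [^] p \<oplus> (b [^] (p ^ e)) [^] p"
    unfolding Suc using assms by (simp add: frobenius_add)
  finally show ?case using assms by (simp add: nat_pow_pow power_Suc2 del: power_Suc)
qed (use assms in simp)

lemma frobenius_power_minus:
  fixes p e :: nat
  assumes "Factorial_Ring.prime p" "add_pow R p \<one> = \<zero>" "a \<in> carrier R" "b \<in> carrier R"
  shows "(a \<ominus> b) [^] (p ^ e) = a [^] (p ^ e) \<ominus> b [^] (p ^ e)"
proof -
  have "((a \<ominus> b) \<oplus> b) [^] (p ^ e) = (a \<ominus> b) [^] (p ^ e) \<oplus> b [^] (p ^ e)"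
    by (rule frobenius_power_add) (use assms in auto)
  moreover have "(a \<ominus> b) \<oplus> b = a" using assms by (simp add: a_minus_def a_assoc l_neg)
  ultimately have "a [^] (p ^ e) = (a \<ominus> b) [^] (p ^ e) \<oplus> b [^] (p ^ e)" by simp
  moreover have "u = (u \<oplus> v) \<ominus> v" if "u \<in> carrier R" "v \<in> carrier R" for u v
    using that by (simp add: a_minus_def a_assoc r_neg)
  ultimately show ?thesis using assms by simp
qed

end

section \<open>Henselian valuation rings with principal maximal ideal\<close>

text \<open>
  A field of characteristic \<open>p\<close> with a valuation ring \<open>V\<close> whose maximal ideal is generated by \<open>t\<close>.
  The value group need not be the integers. Henselianity is only demanded of the polynomials
  \<open>X\<^sup>m - u\<close> with \<open>u\<close> a principal unit, and \<open>residue\<close> says that every unit of the residue field is an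
  \<open>m\<close>-th root of unity. The last condition makes the \<open>Suc m\<close>-th power additive, and \<open>m\<close> prime
  to \<open>p\<close>.
\<close>

locale henselian_valuation = field +
  fixes V :: "'a set" and t :: 'a and p m e :: nat
  assumes subring: "subring V R"
    and t_in: "t \<in> V" and t_nonzero: "t \<noteq> \<zero>"
    and t_nonunit: "r \<in> V \<Longrightarrow> t \<otimes> r \<noteq> \<one>"
    and valuation: "x \<in> carrier R \<Longrightarrow> x \<notin> V \<Longrightarrow> \<exists>r\<in>V. x \<otimes> (t \<otimes> r) = \<one>"
    and residue: "x \<in> V \<Longrightarrow> (\<exists>r\<in>V. x = t \<otimes> r) \<or> (\<exists>r\<in>V. x [^] m = \<one> \<oplus> t \<otimes> r)"
    and hensel: "r \<in> V \<Longrightarrow> \<exists>y\<in>V. y [^] m = \<one> \<oplus> t \<otimes> r"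
    and prime: "Factorial_Ring.prime p"
    and char_p: "add_pow R p \<one> = \<zero>"
    and m_ge: "m \<ge> 2"
    and Suc_m: "Suc m = p ^ e"
begin

lemma V_sub: "x \<in> V \<Longrightarrow> x \<in> carrier R"
  using subringE(1) [OF subring] by blast

lemmas V_closed [simp] = subringE(2,3,5-7) [OF subring]

lemma V_minus [simp]: "x \<in> V \<Longrightarrow> y \<in> V \<Longrightarrow> x \<ominus> y \<in> V"
  by (simp add: a_minus_def)

lemma V_pow [simp]: "x \<in> V \<Longrightarrow> x [^] (k::nat) \<in> V"
  by (induction k) auto

lemma t_carrier [simp]: "t \<in> carrier R" using t_in by (rule V_sub)

lemma t_multiple_or_unit:
  assumes "x \<in> V"
  shows "(\<exists>r\<in>V. x = t \<otimes> r) \<or> (\<exists>r\<in>V. x \<otimes> r = \<one>)"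
proof (cases "x \<otimes> inv t \<in> V")
  have x: "x \<in> carrier R" using assms by (rule V_sub)
  have it: "inv t \<in> carrier R" "t \<otimes> inv t = \<one>"
    using t_nonzero by (auto simp: field_Units)
  case True
  have "t \<otimes> (x \<otimes> inv t) = (t \<otimes> inv t) \<otimes> x" using x it(1) by (simp add: m_ac)
  then have "x = t \<otimes> (x \<otimes> inv t)" using x it by simp
  with True show ?thesis by blast
next
  have x: "x \<in> carrier R" using assms by (rule V_sub)
  have it: "inv t \<in> carrier R" "t \<otimes> inv t = \<one>"
    using t_nonzero by (auto simp: field_Units)
  case False
  then obtain r where r: "r \<in> V" "(x \<otimes> inv t) \<otimes> (t \<otimes> r) = \<one>"
    using valuation [of "x \<otimes> inv t"] x it(1) by auto
  have "(x \<otimes> inv t) \<otimes> (t \<otimes> r) = (x \<otimes> r) \<otimes> (t \<otimes> inv t)"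
    using x it(1) V_sub [OF r(1)] by (simp add: m_ac)
  with r it x V_sub [OF r(1)] show ?thesis by auto
qed

text \<open>
  The element \<open>t\<close> generates the maximal ideal, so its value is the least positive one and is not
  divisible in the value group.
\<close>

lemma pow_neq_uniformizer:
  assumes z: "z \<in> carrier R" and k: "k \<ge> 2" and r: "r \<in> V"
  shows "z [^] (k::nat) \<noteq> t \<otimes> (\<one> \<oplus> t \<otimes> r)"
proof
  assume eq: "z [^] k = t \<otimes> (\<one> \<oplus> t \<otimes> r)"
  let ?u = "\<one> \<oplus> t \<otimes> r"
  have u: "?u \<in> V" using t_in r by simp
  have no_inv: "z \<otimes> s \<noteq> \<one>" if "s \<in> V" for s
  proof
    assume "z \<otimes> s = \<one>"
    then have "\<one> = z [^] k \<otimes> s [^] k" using z V_sub [OF that] by (simp flip: nat_pow_distrib)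
    also have "\<dots> = t \<otimes> (?u \<otimes> s [^] k)"
      unfolding eq using V_sub [OF u] V_sub [OF that] by (simp add: m_assoc)
    finally show False using t_nonunit [of "?u \<otimes> s [^] k"] u that by simp
  qed
  have "z \<in> V"
    using valuation [OF z] no_inv t_in by fastforce
  with no_inv obtain s where s: "s \<in> V" "z = t \<otimes> s"
    using t_multiple_or_unit by blast
  obtain j where j: "k = Suc (Suc j)" using k by (metis add_2_eq_Suc le_Suc_ex)
  have "z [^] k = t \<otimes> (t \<otimes> (t [^] j \<otimes> s [^] k))"
    unfolding s(2) j using V_sub [OF s(1)] by (simp add: nat_pow_distrib m_ac)
  then have "t \<otimes> ?u = t \<otimes> (t \<otimes> (t [^] j \<otimes> s [^] k))" using eq by simp
  then have "?u = t \<otimes> (t [^] j \<otimes> s [^] k)"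
    using m_lcancel [OF t_nonzero t_carrier] V_sub [OF u] V_sub [OF s(1)] by simp
  then have "t \<otimes> (t [^] j \<otimes> s [^] k) \<ominus> t \<otimes> r = ?u \<ominus> t \<otimes> r" by simp
  also have "\<dots> = \<one>"
    using V_sub [OF r] by (simp add: a_minus_def a_assoc r_neg)
  finally have "t \<otimes> (t [^] j \<otimes> s [^] k \<ominus> r) = \<one>"
    using V_sub [OF r] V_sub [OF s(1)] by (simp add: a_minus_def r_distr r_minus)
  then show False using t_nonunit [of "t [^] j \<otimes> s [^] k \<ominus> r"] t_in s(1) r by simp
qed

text \<open>
  The valuation ring is definable: the \<open>m\<close>-th roots exist by Hensel's lemma if \<open>x\<close> is integral,
  and otherwise the value of the right-hand side is not divisible by \<open>m\<close>.
\<close>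

lemma in_V_iff:
  assumes x: "x \<in> carrier R"
  shows "x \<in> V \<longleftrightarrow> (\<exists>y\<in>carrier R. y [^] m = \<one> \<oplus> t \<otimes> x [^] m)"
proof
  assume "x \<in> V"
  then show "\<exists>y\<in>carrier R. y [^] m = \<one> \<oplus> t \<otimes> x [^] m"
    using hensel [of "x [^] m"] V_sub by auto
next
  assume "\<exists>y\<in>carrier R. y [^] m = \<one> \<oplus> t \<otimes> x [^] m"
  then obtain y where y: "y \<in> carrier R" "y [^] m = \<one> \<oplus> t \<otimes> x [^] m" by blast
  show "x \<in> V"
  proof (rule ccontr)
    assume "x \<notin> V"
    then obtain r where r: "r \<in> V" and xr: "x \<otimes> (t \<otimes> r) = \<one>" using valuation [OF x] by blast
    have rc: "r \<in> carrier R" using r by (rule V_sub)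
    let ?s = "t \<otimes> r"
    obtain j where j: "m = Suc (Suc j)" using m_ge by (metis add_2_eq_Suc le_Suc_ex)
    \<comment> \<open>Multiply the equation by the \<open>m\<close>-th power of the inverse of \<open>x\<close>.\<close>
    have "x [^] m \<otimes> ?s [^] m = \<one>"
      using xr x rc by (simp flip: nat_pow_distrib)
    then have "(y \<otimes> ?s) [^] m = ?s [^] m \<oplus> t"
      using x y rc by (simp add: nat_pow_distrib l_distr m_assoc)
    also have "?s [^] m = t \<otimes> (t \<otimes> (t [^] j \<otimes> r [^] m))"
      unfolding j using rc by (simp add: nat_pow_distrib m_ac)
    also have "\<dots> \<oplus> t = t \<otimes> (\<one> \<oplus> t \<otimes> (t [^] j \<otimes> r [^] m))"
      using rc by (simp add: r_distr a_comm)
    finally show False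
      using pow_neq_uniformizer [of "y \<otimes> ?s" m "t [^] j \<otimes> r [^] m"] y(1) rc m_ge r t_in by simp
  qed
qed

text \<open>
  An injection of the plane into the line, which exists because \<open>t\<close> is not a \<open>p\<close>-th power.
\<close>

definition \<iota> :: "'a \<Rightarrow> 'a \<Rightarrow> 'a" where
  "\<iota> x y = x [^] p \<oplus> t \<otimes> y [^] p"

lemma \<iota>_inj:
  assumes "x \<in> carrier R" "y \<in> carrier R" "x' \<in> carrier R" "y' \<in> carrier R" "\<iota> x y = \<iota> x' y'"
  shows "x = x' \<and> y = y'"
proof -
  have p1: "(a \<ominus> b) [^] p = a [^] p \<ominus> b [^] p" if "a \<in> carrier R" "b \<in> carrier R" for a b
    using frobenius_power_minus [OF prime char_p that, of 1] by simp
  have pow_zero: "a = b" if "a \<in> carrier R" "b \<in> carrier R" "(a \<ominus> b) [^] p = \<zero>" for a b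
  proof -
    have "(c::'a) [^] k \<noteq> \<zero>" if "c \<in> carrier R" "c \<noteq> \<zero>" for c and k :: nat
      using that by (induction k) (auto simp: integral_iff)
    then have "a \<ominus> b = \<zero>" using that by blast
    then show ?thesis using that by simp
  qed
  let ?a = "x \<ominus> x'" and ?b = "y' \<ominus> y"
  have "x [^] p \<ominus> x' [^] p = t \<otimes> y' [^] p \<ominus> t \<otimes> y [^] p"
  proof -
    have "x [^] p \<oplus> t \<otimes> y [^] p = x' [^] p \<oplus> t \<otimes> y' [^] p"
      using assms(5) by (simp add: \<iota>_def)
    moreover have "a \<ominus> c = d \<ominus> b"
      if "a \<oplus> b = c \<oplus> d" "a \<in> carrier R" "b \<in> carrier R" "c \<in> carrier R" "d \<in> carrier R" for a b c d
    proof -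
      have "a = c \<oplus> (d \<ominus> b)"
        using that(2-) by (simp flip: a_assoc that(1) add: a_minus_def) (simp add: a_assoc r_neg)
      then have "\<ominus> c \<oplus> a = d \<ominus> b" using that(2-) by (simp add: r_neg1)
      then show ?thesis using that(2-) by (simp add: a_minus_def a_comm)
    qed
    ultimately show ?thesis using assms by simp
  qed
  moreover have "t \<otimes> ?b [^] p = t \<otimes> y' [^] p \<ominus> t \<otimes> y [^] p"
    unfolding p1 [OF assms(4,2)] using assms by (simp add: a_minus_def r_distr r_minus)
  ultimately have eq: "?a [^] p = t \<otimes> ?b [^] p"
    using p1 [OF assms(1,3)] by simp
  have "y' = y"
  proof (rule ccontr)
    assume "y' \<noteq> y"
    then have b: "?b \<in> carrier R" "?b \<noteq> \<zero>" using assms by auto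
    then have ib: "inv ?b \<in> carrier R" "?b \<otimes> inv ?b = \<one>" by (auto simp: field_Units)
    have "(?a \<otimes> inv ?b) [^] p = t \<otimes> (?b \<otimes> inv ?b) [^] p"
      using assms ib(1) b eq by (simp add: nat_pow_distrib m_assoc)
    then have "(?a \<otimes> inv ?b) [^] p = t \<otimes> (\<one> \<oplus> t \<otimes> \<zero>)" by (simp add: ib(2))
    then show False
      using pow_neq_uniformizer [of "?a \<otimes> inv ?b" p \<zero>] ib(1) assms prime_ge_2_nat [OF prime] by simp
  qed
  moreover have "?a [^] p = \<zero>"
  proof -
    have "?b = \<zero>" using \<open>y' = y\<close> assms(2) by simp
    then show ?thesis using prime_gt_0_nat [OF prime] by (simp only: eq) (simp add: nat_pow_zero)
  qed
  ultimately show ?thesis using pow_zero [OF assms(1,3)] by blast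
qed

text \<open>The nonzero elements of \<open>V\<close>, and the \<open>m\<close>-th powers of such elements.\<close>

definition V0 :: "'a set" where "V0 = V - {\<zero>}"

definition pow_V0 :: "'a \<Rightarrow> bool" where "pow_V0 x \<longleftrightarrow> (\<exists>y\<in>V0. y [^] m = x)"

text \<open>
  Multiplication by the \<open>m\<close>-th power of \<open>t\<close> on the \<open>m\<close>-th powers, and the identity elsewhere.
\<close>

definition shrink :: "'a \<Rightarrow> 'a" where "shrink x = (if pow_V0 x then t [^] m \<otimes> x else x)"

lemma V0_sub: "V0 \<subseteq> carrier R" using V_sub by (auto simp: V0_def)

lemma pow_nonzero: "c \<in> carrier R \<Longrightarrow> c \<noteq> \<zero> \<Longrightarrow> c [^] (k::nat) \<noteq> \<zero>"
  by (induction k) (auto simp: integral_iff)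

lemma V0_mult: "x \<in> V0 \<Longrightarrow> y \<in> V0 \<Longrightarrow> x \<otimes> y \<in> V0"
  using V_sub by (auto simp: V0_def integral_iff)

lemma V0_pow: "x \<in> V0 \<Longrightarrow> x [^] (k::nat) \<in> V0"
  using V_sub pow_nonzero by (auto simp: V0_def)

lemma t_V0: "t \<in> V0" and one_V0: "\<one> \<in> V0"
  using t_in t_nonzero by (auto simp: V0_def)

lemma principal_unit_V0:
  assumes "r \<in> V"
  shows "\<one> \<oplus> t \<otimes> r \<in> V0"
proof -
  have "\<one> \<oplus> t \<otimes> r \<noteq> \<zero>"
  proof
    assume *: "\<one> \<oplus> t \<otimes> r = \<zero>"
    have "t \<otimes> (\<ominus> r) = \<ominus> (t \<otimes> r)" using V_sub [OF assms] by (simp add: r_minus)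
    also have "\<dots> = \<one>" using * V_sub [OF assms] by (simp add: minus_equality)
    finally show False using t_nonunit [of "\<ominus> r"] assms by simp
  qed
  then show ?thesis using t_in assms by (simp add: V0_def)
qed

lemma principal_unit_pow_V0:
  assumes "r \<in> V"
  shows "pow_V0 (\<one> \<oplus> t \<otimes> r)"
proof -
  obtain y where y: "y \<in> V" "y [^] m = \<one> \<oplus> t \<otimes> r" using hensel [OF assms] by blast
  have "y \<noteq> \<zero>"
    using y(2) principal_unit_V0 [OF assms] m_ge by (auto simp: V0_def nat_pow_zero)
  with y show ?thesis by (auto simp: pow_V0_def V0_def)
qed

lemma multiple_not_principal_unit:
  assumes "a \<in> V" "r \<in> V"
  shows "t \<otimes> a \<noteq> \<one> \<oplus> t \<otimes> r"
proof
  assume eq: "t \<otimes> a = \<one> \<oplus> t \<otimes> r"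
  have "t \<otimes> (a \<ominus> r) = t \<otimes> a \<ominus> t \<otimes> r"
    using V_sub [OF assms(1)] V_sub [OF assms(2)] by (simp add: a_minus_def r_distr r_minus)
  also have "\<dots> = \<one>"
    unfolding eq using V_sub [OF assms(2)] by (simp add: a_minus_def a_assoc r_neg)
  finally show False using t_nonunit [of "a \<ominus> r"] assms by simp
qed

lemma t_pow_m: "\<exists>s\<in>V. t [^] m = t \<otimes> s"
proof -
  obtain j where "m = Suc j" using m_ge by (cases m) auto
  then show ?thesis using t_in by (auto intro!: bexI [of _ "t [^] j"] simp: m_comm)
qed

lemma shrink_pow_V0: "pow_V0 x \<Longrightarrow> pow_V0 (t [^] m \<otimes> x)"
  unfolding pow_V0_def using V0_mult [OF t_V0] V0_sub by (metis nat_pow_distrib subsetD t_carrier)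

lemma shrink_inj: "inj_on shrink V0"
proof (rule inj_onI)
  fix x y assume xy: "x \<in> V0" "y \<in> V0" "shrink x = shrink y"
  then have c: "x \<in> carrier R" "y \<in> carrier R" using V0_sub by auto
  show "x = y"
  proof (cases "pow_V0 x \<longleftrightarrow> pow_V0 y")
    case same: True
    show ?thesis
    proof (cases "pow_V0 x")
      case True
      with same xy(3) have "t [^] m \<otimes> x = t [^] m \<otimes> y" by (simp add: shrink_def)
      then show ?thesis using m_lcancel [OF pow_nonzero [OF t_carrier t_nonzero]] c by simp
    next
      case False
      with same xy(3) show ?thesis by (simp add: shrink_def)
    qed
  next
    case False
    then have "pow_V0 (shrink x) \<noteq> pow_V0 (shrink y)" using shrink_pow_V0 [of x] shrink_pow_V0 [of y] by (auto simp: shrink_def)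
    with xy(3) show ?thesis by simp
  qed
qed

text \<open>
  An \<open>m\<close>-th power of a unit is a principal unit and conversely, so the map misses exactly the
  principal units.
\<close>

lemma shrink_image: "shrink ` V0 = V0 - {\<one> \<oplus> t \<otimes> r |r. r \<in> V}"
proof
  show "shrink ` V0 \<subseteq> V0 - {\<one> \<oplus> t \<otimes> r |r. r \<in> V}"
  proof (rule image_subsetI)
    fix x assume x: "x \<in> V0"
    then have xV: "x \<in> V" "x \<in> carrier R" using V0_sub by (auto simp: V0_def)
    show "shrink x \<in> V0 - {\<one> \<oplus> t \<otimes> r |r. r \<in> V}"
    proof (cases "pow_V0 x")
      case True
      obtain s where s: "s \<in> V" "t [^] m = t \<otimes> s" using t_pow_m by blast
      have "t [^] m \<otimes> x = t \<otimes> (s \<otimes> x)" unfolding s(2) using V_sub [OF s(1)] xV by (simp add: m_assoc)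
      then have "shrink x = t \<otimes> (s \<otimes> x)" using True by (simp add: shrink_def)
      moreover have "shrink x \<in> V0" using True V0_mult [OF V0_pow [OF t_V0] x] by (simp add: shrink_def)
      ultimately show ?thesis
        using multiple_not_principal_unit [of "s \<otimes> x"] s(1) xV by auto
    next
      case False
      then show ?thesis using x principal_unit_pow_V0 by (auto simp: shrink_def)
    qed
  qed
  show "V0 - {\<one> \<oplus> t \<otimes> r |r. r \<in> V} \<subseteq> shrink ` V0"
  proof
    fix x assume x: "x \<in> V0 - {\<one> \<oplus> t \<otimes> r |r. r \<in> V}"
    show "x \<in> shrink ` V0"
    proof (cases "pow_V0 x")
      case False
      then show ?thesis using x by (auto simp: shrink_def intro!: image_eqI [of x shrink x])
    next
      case True
      then obtain y where y: "y \<in> V0" "y [^] m = x" by (auto simp: pow_V0_def)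
      then obtain z where z: "z \<in> V" "y = t \<otimes> z"
        using residue [of y] x by (auto simp: V0_def)
      then have z0: "z \<in> V0" using y(1) by (auto simp: V0_def)
      have "x = t [^] m \<otimes> z [^] m"
        using y(2) z V_sub [OF z(1)] by (simp add: nat_pow_distrib)
      moreover have "pow_V0 (z [^] m)" using z0 by (auto simp: pow_V0_def)
      ultimately have "x = shrink (z [^] m)" by (simp add: shrink_def)
      then show ?thesis using V0_pow [OF z0] by blast
    qed
  qed
qed

text \<open>The principal units other than \<open>\<one>\<close>.\<close>

definition U1 :: "'a set" where "U1 = (\<lambda>x. \<one> \<oplus> t \<otimes> x) ` V0"

lemma principal_units: "{\<one> \<oplus> t \<otimes> r |r. r \<in> V} = insert \<one> U1"
proof -
  have "V = insert \<zero> V0" by (auto simp: V0_def)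
  moreover have "{\<one> \<oplus> t \<otimes> r |r. r \<in> V} = (\<lambda>r. \<one> \<oplus> t \<otimes> r) ` V" by blast
  ultimately have "{\<one> \<oplus> t \<otimes> r |r. r \<in> V} = (\<lambda>r. \<one> \<oplus> t \<otimes> r) ` insert \<zero> V0" by simp
  then show ?thesis by (simp add: U1_def)
qed

lemma one_notin_U1: "\<one> \<notin> U1"
proof
  assume "\<one> \<in> U1"
  then obtain x where x: "x \<in> V0" "\<one> = \<one> \<oplus> t \<otimes> x" by (auto simp: U1_def)
  then have xc: "x \<in> carrier R" "x \<noteq> \<zero>" using V0_sub by (auto simp: V0_def)
  have "\<one> \<oplus> t \<otimes> x = \<one> \<oplus> \<zero>" using x(2) by simp
  then have "t \<otimes> x = \<zero>" using xc(1) add.l_cancel [of \<one> "t \<otimes> x" \<zero>] by simp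
  then show False using xc t_nonzero by (simp add: integral_iff)
qed

lemma V0_decomp: "V0 = shrink ` V0 \<union> U1 \<union> {\<one>}" "shrink ` V0 \<inter> U1 = {}" "\<one> \<notin> shrink ` V0"
proof -
  have "insert \<one> U1 \<subseteq> V0" unfolding principal_units [symmetric] using principal_unit_V0 by auto
  moreover have "shrink ` V0 = V0 - insert \<one> U1" unfolding shrink_image principal_units ..
  ultimately show "V0 = shrink ` V0 \<union> U1 \<union> {\<one>}" "shrink ` V0 \<inter> U1 = {}" "\<one> \<notin> shrink ` V0"
    by blast+
qed

lemma U1_inj: "inj_on (\<lambda>x. \<one> \<oplus> t \<otimes> x) V0"
proof (rule inj_onI)
  fix x y assume *: "x \<in> V0" "y \<in> V0" "\<one> \<oplus> t \<otimes> x = \<one> \<oplus> t \<otimes> y"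
  then have c: "x \<in> carrier R" "y \<in> carrier R" using V0_sub by auto
  then have "t \<otimes> x = t \<otimes> y" using *(3) add.l_cancel [of \<one> "t \<otimes> x" "t \<otimes> y"] by simp
  then show "x = y" using m_lcancel [OF t_nonzero t_carrier c] by simp
qed

subsection \<open>Definability\<close>

lemma def_V0: "def_pred R (\<lambda>v. v i \<in> V0)"
proof (rule def_pred_cong)
  show "def_pred R (\<lambda>v. (\<exists>y\<in>carrier R. y [^] m = \<one> \<oplus> t \<otimes> v i [^] m) \<and> \<not> v i = \<zero>)"
    by (intro def_intros t_carrier one_closed zero_closed)
qed (auto simp: V0_def in_V_iff image_subset_iff)

lemma def_pow_V0: "def_pred R (\<lambda>v. pow_V0 (v i))"
proof (rule def_pred_cong)
  show "def_pred R (\<lambda>v. \<exists>y\<in>carrier R. y \<in> V0 \<and> y [^] m = v i)"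
    by (intro def_intros def_V0)
qed (use V0_sub in \<open>auto simp: pow_V0_def\<close>)

lemma def_shrink: "def_fun R (\<lambda>v. shrink (v i))"
  unfolding shrink_def by (intro def_intros def_pow_V0 nat_pow_closed t_carrier)

lemma def_\<iota>: "def_fun R s \<Longrightarrow> def_fun R s' \<Longrightarrow> def_fun R (\<lambda>v. \<iota> (s v) (s' v))"
  unfolding \<iota>_def by (intro def_intros t_carrier)

lemmas defs = def_intros def_shrink def_\<iota> t_carrier one_closed zero_closed

lemma def_V0': "def_pred R (\<lambda>v. v 0 \<in> V0)" by (rule def_V0)

subsection \<open>Removing a point\<close>

text \<open>The injection on pairs.\<close>

abbreviation "I \<equiv> \<lambda>(x, y). \<iota> x y"

lemma I_inj: "inj_on I (carrier R \<times> carrier R)"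
  using \<iota>_inj by (auto intro!: inj_onI)

lemma I_disjoint:
  assumes "S \<subseteq> V0 \<times> V0" "T \<subseteq> V0 \<times> V0" "S \<inter> T = {}"
  shows "I ` S \<inter> I ` T = {}"
proof -
  have "V0 \<times> V0 \<subseteq> carrier R \<times> carrier R" using V0_sub by blast
  then have "inj_on I (V0 \<times> V0)" by (rule inj_on_subset [OF I_inj])
  from inj_on_image_Int [OF this assms(1,2)] assms(3) show ?thesis by simp
qed

text \<open>
  A definable injection \<open>(f, g)\<close> of the square of \<open>V0\<close> into the plane makes the images under \<open>I\<close> of
  the square and of its copy equivalent.
\<close>

lemma I_param:
  assumes "\<And>x y. x \<in> V0 \<Longrightarrow> y \<in> V0 \<Longrightarrow> f x y \<in> carrier R \<and> g x y \<in> carrier R"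
    and "inj_on (\<lambda>(x, y). (f x y, g x y)) (V0 \<times> V0)"
    and "def_fun R (\<lambda>v. f (v 0) (v (Suc 0)))" "def_fun R (\<lambda>v. g (v 0) (v (Suc 0)))"
  shows "def_equiv R (I ` (V0 \<times> V0)) (I ` ((\<lambda>(x, y). (f x y, g x y)) ` (V0 \<times> V0)))"
proof -
  have "def_equiv R ((\<lambda>(x, y). \<iota> x y) ` (V0 \<times> V0)) ((\<lambda>(x, y). \<iota> (f x y) (g x y)) ` (V0 \<times> V0))"
  proof (rule def_equiv_image2 [OF V0_sub def_V0'])
    show "inj_on (\<lambda>(x, y). \<iota> x y) (V0 \<times> V0)"
      by (rule inj_on_subset [OF I_inj]) (use V0_sub in auto)
    show "inj_on (\<lambda>(x, y). \<iota> (f x y) (g x y)) (V0 \<times> V0)"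
    proof (rule inj_onI, clarify)
      fix x y x' y' assume *: "x \<in> V0" "y \<in> V0" "x' \<in> V0" "y' \<in> V0"
        "\<iota> (f x y) (g x y) = \<iota> (f x' y') (g x' y')"
      have "f x y = f x' y' \<and> g x y = g x' y'"
        by (rule \<iota>_inj) (use assms(1) * in simp_all)
      then show "x = x' \<and> y = y'"
        using inj_onD [OF assms(2), of "(x, y)" "(x', y')"] * by simp
    qed
  qed (intro defs assms)+
  moreover have "(\<lambda>(x, y). \<iota> (f x y) (g x y)) ` (V0 \<times> V0) =
      I ` ((\<lambda>(x, y). (f x y, g x y)) ` (V0 \<times> V0))"
    unfolding image_image by (rule image_cong) auto
  ultimately show ?thesis by simp
qed

lemma I_param1:
  assumes "\<And>x. x \<in> V0 \<Longrightarrow> g x \<in> carrier R" "inj_on g V0" "def_fun R (\<lambda>v. g (v 0))"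
  shows "def_equiv R V0 (I ` ({\<one>} \<times> g ` V0))"
proof -
  have "def_equiv R V0 ((\<lambda>x. \<iota> \<one> (g x)) ` V0)"
  proof (rule def_equiv_image [OF V0_sub def_V0'])
    show "def_fun R (\<lambda>v. \<iota> \<one> (g (v 0)))" by (intro defs assms)
    show "inj_on (\<lambda>x. \<iota> \<one> (g x)) V0"
    proof (rule inj_onI)
      fix x y assume xy: "x \<in> V0" "y \<in> V0" "\<iota> \<one> (g x) = \<iota> \<one> (g y)"
      have "g x = g y"
        using \<iota>_inj [OF one_closed assms(1) one_closed assms(1) xy(3)] xy(1,2) by simp
      then show "x = y" using xy(1,2) by (rule inj_onD [OF assms(2)])
    qed
  qed
  moreover have "(\<lambda>x. \<iota> \<one> (g x)) ` V0 = I ` ({\<one>} \<times> g ` V0)" by auto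
  ultimately show ?thesis by simp
qed

end

context ring
begin

text \<open>
  If a set \<open>Y\<close> absorbs \<open>W\<close>, and \<open>W\<close> is made of two copies of itself and one more point \<open>c\<close>, then
  \<open>Y\<close> absorbs one of the copies of \<open>W\<close> after the other and so loses the point \<open>c\<close>.
\<close>

lemma def_equiv_remove_point:
  assumes Y: "Y = A \<union> W" "A \<inter> W = {}" and A: "def_equiv R A Y"
    and W: "W = B \<union> C \<union> {c}" "B \<inter> C = {}" "c \<notin> B" "c \<notin> C"
    and B: "def_equiv R B W" and C: "def_equiv R C W"
  shows "def_equiv R (Y - {c}) Y"
proof -
  have "def_equiv R (A \<union> B) (A \<union> W)"
    by (rule def_equiv_Un [OF def_equiv_trans [OF A def_equiv_sym [OF A]] B]) (use Y W in auto)
  then have "def_equiv R (A \<union> B) A"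
    unfolding Y(1) [symmetric] by (rule def_equiv_trans [OF _ def_equiv_sym [OF A]])
  then have "def_equiv R ((A \<union> B) \<union> C) (A \<union> W)"
    by (rule def_equiv_Un [OF _ C]) (use Y W in auto)
  moreover have "(A \<union> B) \<union> C = Y - {c}" using Y W by auto
  ultimately show ?thesis unfolding Y(1) by simp
qed

text \<open>
  It is enough to remove some point from some definable set: the bijection extends by the identity,
  and a translation moves the missing point to zero.
\<close>

lemma carrier_equiv_nonzeroI:
  assumes Y: "def_equiv R (Y - {c}) Y" and c: "c \<in> Y"
  shows "def_equiv R (carrier R) (carrier R - {\<zero>})"
proof -
  have Yc: "Y \<subseteq> carrier R" using Y by (simp add: def_equiv_def)
  have def_Y: "def_pred R (\<lambda>v. v 0 \<in> Y)" by (rule def_equiv_dom [OF def_equiv_sym [OF Y]])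
  have "def_pred R (\<lambda>v. v 0 \<in> carrier R - Y)"
    by (rule def_pred_cong [OF def_pred_not [OF def_Y]]) auto
  then have "def_equiv R (carrier R - Y) (carrier R - Y)"
    by (intro def_equiv_refl) auto
  then have "def_equiv R ((Y - {c}) \<union> (carrier R - Y)) (Y \<union> (carrier R - Y))"
    by (rule def_equiv_Un [OF Y]) auto
  moreover have "(Y - {c}) \<union> (carrier R - Y) = carrier R - {c}" "Y \<union> (carrier R - Y) = carrier R"
    using Yc c by auto
  ultimately have 1: "def_equiv R (carrier R) (carrier R - {c})"
    by (simp add: def_equiv_sym)
  have cc: "c \<in> carrier R" using Yc c by blast
  have "def_equiv R (carrier R - {c}) ((\<lambda>x. x \<oplus> \<ominus> c) ` (carrier R - {c}))"
  proof (rule def_equiv_image)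
    show "def_pred R (\<lambda>v. v 0 \<in> carrier R - {c})"
      by (rule def_equiv_dom [OF def_equiv_sym [OF 1]])
    show "def_fun R (\<lambda>v. v 0 \<oplus> \<ominus> c)" by (intro def_intros a_inv_closed cc)
    show "inj_on (\<lambda>x. x \<oplus> \<ominus> c) (carrier R - {c})" using cc by (auto intro!: inj_onI)
  qed auto
  moreover have "(\<lambda>x. x \<oplus> \<ominus> c) ` (carrier R - {c}) = carrier R - {\<zero>}"
  proof
    show "(\<lambda>x. x \<oplus> \<ominus> c) ` (carrier R - {c}) \<subseteq> carrier R - {\<zero>}"
      using cc by (auto simp flip: a_minus_def)
    show "carrier R - {\<zero>} \<subseteq> (\<lambda>x. x \<oplus> \<ominus> c) ` (carrier R - {c})"
    proof
      fix x assume x: "x \<in> carrier R - {\<zero>}"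
      show "x \<in> (\<lambda>x. x \<oplus> \<ominus> c) ` (carrier R - {c})"
      proof (rule image_eqI)
        show "x = (x \<oplus> c) \<oplus> \<ominus> c" using x cc by (simp add: a_assoc r_neg)
        show "x \<oplus> c \<in> carrier R - {c}"
          using x cc by (auto simp: add.l_cancel_one add.r_cancel_one)
      qed
    qed
  qed
  ultimately show ?thesis using def_equiv_trans [OF 1] by simp
qed

end

context henselian_valuation
begin

text \<open>
  The set \<open>Y\<close> that loses a point is the image of the square of \<open>V0\<close>. It absorbs \<open>V0\<close>, because the
  pairs with first coordinate different from \<open>\<one>\<close> make up two copies of the square, that is, the
  whole square up to a definable bijection.
\<close>

lemma carrier_equiv_nonzero: "def_equiv R (carrier R) (carrier R - {\<zero>})"
proof -
  have V0c: "x \<in> carrier R" if "x \<in> V0" for x using that V0_sub by blast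
  have V0n: "x \<noteq> \<zero>" if "x \<in> V0" for x using that by (simp add: V0_def)
  have hc: "shrink x \<in> carrier R" if "x \<in> V0" for x using that V0_decomp(1) V0c by blast
  have Nc: "\<one> \<oplus> t \<otimes> x \<in> carrier R" if "x \<in> V0" for x using V0c [OF that] by simp
  let ?Y = "I ` (V0 \<times> V0)"
  let ?A = "(\<lambda>(x, y). (x, x \<otimes> y)) ` (V0 \<times> V0)"
  let ?B = "(\<lambda>(x, y). (t \<otimes> (x \<otimes> y), y)) ` (V0 \<times> V0)"
  \<comment> \<open>The square splits into two copies of itself, according to which coordinate divides the other.\<close>
  have A: "def_equiv R ?Y (I ` ?A)"
  proof (rule I_param)
    show "inj_on (\<lambda>(x, y). (x, x \<otimes> y)) (V0 \<times> V0)"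
      using m_lcancel [OF V0n V0c V0c V0c] by (auto intro!: inj_onI)
    show "x \<in> carrier R \<and> x \<otimes> y \<in> carrier R" if "x \<in> V0" "y \<in> V0" for x y
      using that V0c by simp
  qed (intro defs)+
  have B: "def_equiv R ?Y (I ` ?B)"
  proof (rule I_param)
    show "inj_on (\<lambda>(x, y). (t \<otimes> (x \<otimes> y), y)) (V0 \<times> V0)"
      using m_lcancel [OF t_nonzero t_carrier V0c V0c, OF V0_mult V0_mult]
        m_rcancel [OF V0n V0c V0c V0c] by (auto intro!: inj_onI)
    show "t \<otimes> (x \<otimes> y) \<in> carrier R \<and> y \<in> carrier R" if "x \<in> V0" "y \<in> V0" for x y
      using that V0c by simp
  qed (intro defs)+
  have AB: "?A \<union> ?B = V0 \<times> V0" "?A \<inter> ?B = {}"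
  proof -
    show "?A \<inter> ?B = {}"
    proof (rule ccontr)
      assume "?A \<inter> ?B \<noteq> {}"
      then obtain x y x' y' where *: "x \<in> V0" "y \<in> V0" "x' \<in> V0" "y' \<in> V0"
        "x = t \<otimes> (x' \<otimes> y')" "x \<otimes> y = y'" by auto
      have "x = t \<otimes> (x' \<otimes> (x \<otimes> y))" by (subst *(5)) (simp only: *(6))
      also have "\<dots> = x \<otimes> (t \<otimes> (x' \<otimes> y))" using *(1-3) V0c by (simp add: m_ac)
      finally have "x \<otimes> \<one> = x \<otimes> (t \<otimes> (x' \<otimes> y))" using V0c *(1) by simp
      then have "t \<otimes> (x' \<otimes> y) = \<one>"
        using m_lcancel [OF V0n V0c V0c V0c, OF *(1,1) one_V0 V0_mult [OF t_V0 V0_mult [OF *(3,2)]]] by simp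
      then show False using t_nonunit V0_mult [OF *(3,2)] by (simp add: V0_def)
    qed
    show "?A \<union> ?B = V0 \<times> V0"
    proof
      show "?A \<union> ?B \<subseteq> V0 \<times> V0" using V0_mult t_V0 by auto
      show "V0 \<times> V0 \<subseteq> ?A \<union> ?B"
      proof clarify
        fix x y assume xy: "x \<in> V0" "y \<in> V0" "(x, y) \<notin> ?B"
        have ix: "inv x \<in> carrier R" "x \<otimes> inv x = \<one>" using V0c [OF xy(1)] V0n [OF xy(1)] by (auto simp: field_Units)
        let ?z = "inv x \<otimes> y"
        have zc: "?z \<in> carrier R" using ix xy V0c by simp
        have xz: "x \<otimes> ?z = y" using ix xy V0c by (simp flip: m_assoc)
        have z0: "?z \<noteq> \<zero>" using xz V0n [OF xy(2)] V0c [OF xy(1)] by auto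
        have "?z \<in> V"
        proof (rule ccontr)
          assume "?z \<notin> V"
          then obtain r where r: "r \<in> V" "?z \<otimes> (t \<otimes> r) = \<one>" using valuation [OF zc] by blast
          have "x = x \<otimes> (?z \<otimes> (t \<otimes> r))" using r V0c [OF xy(1)] by simp
          also have "\<dots> = (x \<otimes> ?z) \<otimes> (t \<otimes> r)" using zc V0c [OF xy(1)] V_sub [OF r(1)] by (simp add: m_assoc)
          also have "\<dots> = t \<otimes> (r \<otimes> y)" unfolding xz using V0c [OF xy(2)] V_sub [OF r(1)] by (simp add: m_ac)
          finally have x: "x = t \<otimes> (r \<otimes> y)" .
          then have "r \<noteq> \<zero>" using V0n [OF xy(1)] V0c [OF xy(2)] by auto
          then have "(x, y) \<in> ?B" using r(1) xy(2) x by (auto simp: V0_def intro!: image_eqI [of _ _ "(r, y)"])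
          then show False using xy(3) by blast
        qed
        then show "(x, y) \<in> ?A"
          using z0 xz xy(1) by (auto simp: V0_def intro!: image_eqI [of _ _ "(x, ?z)"])
      qed
    qed
  qed
  \<comment> \<open>The decomposition of the first factor exhibits two disjoint copies of the square.\<close>
  let ?H = "shrink ` V0 \<times> V0" and ?N = "U1 \<times> V0"
  have "def_equiv R ?Y (I ` ((\<lambda>(x, y). (shrink x, y)) ` (V0 \<times> V0)))"
  proof (rule I_param)
    show "inj_on (\<lambda>(x, y). (shrink x, y)) (V0 \<times> V0)"
      using inj_onD [OF shrink_inj] by (auto intro!: inj_onI)
    show "shrink x \<in> carrier R \<and> y \<in> carrier R" if "x \<in> V0" "y \<in> V0" for x y
      using that V0c hc by simp
  qed (intro defs)+
  moreover have "(\<lambda>(x, y). (shrink x, y)) ` (V0 \<times> V0) = ?H" by auto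
  ultimately have H: "def_equiv R ?Y (I ` ?H)" by simp
  have "def_equiv R ?Y (I ` ((\<lambda>(x, y). (\<one> \<oplus> t \<otimes> x, y)) ` (V0 \<times> V0)))"
  proof (rule I_param)
    show "inj_on (\<lambda>(x, y). (\<one> \<oplus> t \<otimes> x, y)) (V0 \<times> V0)"
      using inj_onD [OF U1_inj] by (auto intro!: inj_onI)
    show "\<one> \<oplus> t \<otimes> x \<in> carrier R \<and> y \<in> carrier R" if "x \<in> V0" "y \<in> V0" for x y
      using that V0c Nc by simp
  qed (intro defs)+
  moreover have "(\<lambda>(x, y). (\<one> \<oplus> t \<otimes> x, y)) ` (V0 \<times> V0) = ?N" by (auto simp: U1_def)
  ultimately have N: "def_equiv R ?Y (I ` ?N)" by simp
  have sub: "shrink ` V0 \<subseteq> V0" "U1 \<subseteq> V0" "{\<one>} \<subseteq> V0" using V0_decomp(1) by auto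
  have Asub: "?A \<subseteq> V0 \<times> V0" "?B \<subseteq> V0 \<times> V0" using AB(1) by blast+
  let ?HN = "I ` ?H \<union> I ` ?N"
  have "def_equiv R ?HN (I ` ?A \<union> I ` ?B)"
  proof (rule def_equiv_Un)
    show "def_equiv R (I ` ?H) (I ` ?A)" by (rule def_equiv_trans [OF def_equiv_sym [OF H] A])
    show "def_equiv R (I ` ?N) (I ` ?B)" by (rule def_equiv_trans [OF def_equiv_sym [OF N] B])
    show "I ` ?H \<inter> I ` ?N = {}" using sub V0_decomp(2) by (intro I_disjoint) auto
    show "I ` ?A \<inter> I ` ?B = {}" by (rule I_disjoint [OF Asub AB(2)])
  qed
  moreover have "I ` ?A \<union> I ` ?B = ?Y" by (simp only: image_Un [symmetric] AB(1))
  ultimately have HN: "def_equiv R ?HN ?Y" by simp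
  \<comment> \<open>What remains is a copy of \<open>V0\<close>, which is made of two copies of itself and one further point.\<close>
  let ?W = "I ` ({\<one>} \<times> V0)" and ?WH = "I ` ({\<one>} \<times> shrink ` V0)" and ?WN = "I ` ({\<one>} \<times> U1)"
  have W: "def_equiv R V0 ?W"
    using I_param1 [of "\<lambda>x. x"] V0c def_fun_var by simp
  have WH: "def_equiv R V0 ?WH" by (rule I_param1 [OF hc shrink_inj def_shrink])
  have "def_fun R (\<lambda>v. \<one> \<oplus> t \<otimes> v 0)" by (intro defs)
  from I_param1 [OF Nc U1_inj this] have WN: "def_equiv R V0 ?WN" by (simp only: U1_def)
  have Y: "?HN \<union> ?W = ?Y"
  proof -
    have "?H \<union> ?N \<union> {\<one>} \<times> V0 = V0 \<times> V0" using V0_decomp(1) by blast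
    then show ?thesis by (simp only: image_Un [symmetric])
  qed
  have "shrink ` V0 \<inter> {\<one>} = {}" "U1 \<inter> {\<one>} = {}" using V0_decomp(3) one_notin_U1 by simp_all
  then have HW: "?H \<inter> {\<one>} \<times> V0 = {}" and NW: "?N \<inter> {\<one>} \<times> V0 = {}" by blast+
  have HQ: "?H \<subseteq> V0 \<times> V0" and NQ: "?N \<subseteq> V0 \<times> V0" and WQ: "{\<one>} \<times> V0 \<subseteq> V0 \<times> V0"
    using sub by blast+
  note disj = I_disjoint [OF HQ WQ HW] I_disjoint [OF NQ WQ NW]
  have Q: "{\<one>} \<times> S \<subseteq> V0 \<times> V0" if "S \<subseteq> V0" for S using that one_V0 by blast
  have disj': "I ` ({\<one>} \<times> S) \<inter> I ` ({\<one>} \<times> T) = {}"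
    if "S \<subseteq> V0" "T \<subseteq> V0" "S \<inter> T = {}" for S T
  proof (rule I_disjoint [OF Q [OF that(1)] Q [OF that(2)]])
    show "({\<one>} \<times> S) \<inter> ({\<one>} \<times> T) = {}" using that(3) by blast
  qed
  let ?pt = "\<iota> \<one> \<one>"
  have pt: "I ` ({\<one>} \<times> {\<one>}) = {?pt}" by simp
  have "{\<one>} \<times> (S \<union> T \<union> {\<one>}) = {\<one>} \<times> S \<union> {\<one>} \<times> T \<union> {\<one>} \<times> {\<one>}" for S T :: "'a set" by blast
  from this [of "shrink ` V0" U1, folded V0_decomp(1)]
  have "?W = I ` ({\<one>} \<times> shrink ` V0 \<union> {\<one>} \<times> U1 \<union> {\<one>} \<times> {\<one>})" by (rule arg_cong)
  then have W_decomp: "?W = ?WH \<union> ?WN \<union> {?pt}" by (simp only: image_Un pt)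
  have "def_equiv R (?Y - {?pt}) ?Y"
  proof (rule def_equiv_remove_point [OF Y [symmetric] _ HN W_decomp])
    show "?HN \<inter> ?W = {}" using disj by (simp only: Int_Un_distrib2 Un_empty_left)
    show "?WH \<inter> ?WN = {}" by (rule disj' [OF sub(1,2) V0_decomp(2)])
    have "?WH \<inter> {?pt} = {}"
      unfolding pt [symmetric] by (rule disj' [OF sub(1,3)]) (simp add: V0_decomp(3))
    then show "?pt \<notin> ?WH" by blast
    have "?WN \<inter> {?pt} = {}"
      unfolding pt [symmetric] by (rule disj' [OF sub(2,3)]) (simp add: one_notin_U1)
    then show "?pt \<notin> ?WN" by blast
    show "def_equiv R ?WH ?W" by (rule def_equiv_trans [OF def_equiv_sym [OF WH] W])
    show "def_equiv R ?WN ?W" by (rule def_equiv_trans [OF def_equiv_sym [OF WN] W])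
  qed
  then show ?thesis
  proof (rule carrier_equiv_nonzeroI)
    show "?pt \<in> ?Y" using one_V0 by (intro image_eqI [of _ _ "(\<one>, \<one>)"]) auto
  qed
qed

end

section \<open>Laurent series\<close>

context cring
begin

lemma affine_diff:
  assumes "d \<in> carrier R" "c \<in> carrier R" "c' \<in> carrier R" "w \<in> carrier R" "y \<in> carrier R" "y' \<in> carrier R"
  shows "d \<otimes> (c \<ominus> w \<otimes> y) \<ominus> d \<otimes> (c' \<ominus> w \<otimes> y') = d \<otimes> ((c \<ominus> c') \<ominus> w \<otimes> (y \<ominus> y'))"
  using assms by algebra

lemma add_minus_cancel:
  assumes "x \<in> carrier R" "y \<in> carrier R"
  shows "y \<oplus> (x \<ominus> y) = x"
  using assms by algebra

text \<open>The ring of Laurent series over \<open>R\<close>.\<close>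

abbreviation L :: "(int \<Rightarrow> 'a) ring" where "L \<equiv> laurent_ring R"

text \<open>The series of order at least \<open>n\<close>.\<close>

definition ord_ge :: "int \<Rightarrow> (int \<Rightarrow> 'a) set" where
  "ord_ge n = {f. range f \<subseteq> carrier R \<and> (\<forall>i<n. f i = \<zero>)}"

lemma carrier_L: "f \<in> carrier L \<longleftrightarrow> (\<exists>n. f \<in> ord_ge n)"
  by (auto simp: laurent_ring_def ord_ge_def)

lemma ord_ge_carrier: "f \<in> ord_ge n \<Longrightarrow> f \<in> carrier L"
  unfolding carrier_L by blast

lemma ord_ge_coeff: "f \<in> ord_ge n \<Longrightarrow> f i \<in> carrier R"
  by (auto simp: ord_ge_def)

lemma coeff_closed: "f \<in> carrier L \<Longrightarrow> f i \<in> carrier R"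
  unfolding carrier_L using ord_ge_coeff by blast

lemma ord_ge_zero: "f \<in> ord_ge n \<Longrightarrow> i < n \<Longrightarrow> f i = \<zero>"
  by (auto simp: ord_ge_def)

lemma ord_geI: "f \<in> carrier L \<Longrightarrow> (\<And>i. i < n \<Longrightarrow> f i = \<zero>) \<Longrightarrow> f \<in> ord_ge n"
  using coeff_closed by (auto simp: ord_ge_def)

lemma ord_ge_mono: "f \<in> ord_ge n \<Longrightarrow> k \<le> n \<Longrightarrow> f \<in> ord_ge k"
  by (auto simp: ord_ge_def)

lemma L_add: "(f \<oplus>\<^bsub>L\<^esub> g) n = f n \<oplus> g n"
  and L_zero: "\<zero>\<^bsub>L\<^esub> n = \<zero>"
  and L_one: "\<one>\<^bsub>L\<^esub> n = (if n = 0 then \<one> else \<zero>)"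
  by (simp_all add: laurent_ring_def)

lemma mult_coeff:
  assumes "f \<in> carrier L" "g \<in> carrier L" "finite A"
    and A: "\<And>i. i \<notin> A \<Longrightarrow> f i = \<zero> \<or> g (n - i) = \<zero>"
  shows "(f \<otimes>\<^bsub>L\<^esub> g) n = (\<Oplus>i\<in>A. f i \<otimes> g (n - i))"
proof -
  have cl: "f i \<in> carrier R" "g i \<in> carrier R" for i
    using assms(1,2) by (simp_all add: coeff_closed)
  have "(f \<otimes>\<^bsub>L\<^esub> g) n = (\<Oplus>i\<in>{i. f i \<noteq> \<zero> \<and> g (n - i) \<noteq> \<zero>}. f i \<otimes> g (n - i))"
    by (simp add: laurent_ring_def)
  also have "\<dots> = (\<Oplus>i\<in>A. f i \<otimes> g (n - i))"
    by (rule add.finprod_mono_neutral_cong_left) (use A assms(3) cl in auto)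
  finally show ?thesis .
qed

lemma mult_coeff_interval:
  assumes "f \<in> ord_ge a" "g \<in> ord_ge b"
  shows "(f \<otimes>\<^bsub>L\<^esub> g) n = (\<Oplus>i\<in>{a..n - b}. f i \<otimes> g (n - i))"
proof (rule mult_coeff)
  fix i assume "i \<notin> {a..n - b}"
  then have "i < a \<or> n - i < b" by auto
  then show "f i = \<zero> \<or> g (n - i) = \<zero>" using assms by (auto simp: ord_ge_zero)
qed (use assms ord_ge_carrier in auto)

lemma ord_ge_mult:
  assumes "f \<in> ord_ge a" "g \<in> ord_ge b"
  shows "f \<otimes>\<^bsub>L\<^esub> g \<in> ord_ge (a + b)"
  using assms unfolding ord_ge_def [of "a + b"]
  by (auto simp: mult_coeff_interval ord_ge_coeff intro!: finsum_closed)

lemma lowest_coeff_mult: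
  assumes "f \<in> ord_ge a" "g \<in> ord_ge b"
  shows "(f \<otimes>\<^bsub>L\<^esub> g) (a + b) = f a \<otimes> g b"
  using assms by (simp add: mult_coeff_interval ord_ge_coeff)

lemma ord_ge_add: "f \<in> ord_ge a \<Longrightarrow> g \<in> ord_ge a \<Longrightarrow> f \<oplus>\<^bsub>L\<^esub> g \<in> ord_ge a"
  by (auto simp: ord_ge_def L_add image_subset_iff)

lemma finsum_swap:
  assumes "finite A" "finite B" "\<And>i j. i \<in> A \<Longrightarrow> j \<in> B \<Longrightarrow> f i j \<in> carrier R"
  shows "(\<Oplus>i\<in>A. \<Oplus>j\<in>B. f i j) = (\<Oplus>j\<in>B. \<Oplus>i\<in>A. f i j)"
  using assms(1,3)
proof (induction A rule: finite_induct)
  case empty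
  then show ?case by simp
next
  case (insert a A)
  have "(\<Oplus>i\<in>insert a A. \<Oplus>j\<in>B. f i j) = (\<Oplus>j\<in>B. f a j) \<oplus> (\<Oplus>j\<in>B. \<Oplus>i\<in>A. f i j)"
    using insert by (subst finsum_insert) auto
  also have "\<dots> = (\<Oplus>j\<in>B. f a j \<oplus> (\<Oplus>i\<in>A. f i j))"
    using insert by (subst finsum_addf) auto
  also have "\<dots> = (\<Oplus>j\<in>B. \<Oplus>i\<in>insert a A. f i j)"
    using insert by (intro finsum_cong') auto
  finally show ?case .
qed

lemma L_mult_comm:
  assumes "f \<in> carrier L" "g \<in> carrier L"
  shows "f \<otimes>\<^bsub>L\<^esub> g = g \<otimes>\<^bsub>L\<^esub> f"
proof
  fix n
  obtain a b where ab: "f \<in> ord_ge a" "g \<in> ord_ge b" using assms unfolding carrier_L by blast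
  have im: "(\<lambda>i. n - i) ` {b..n - a} = {a..n - b}"
  proof
    show "{a..n - b} \<subseteq> (\<lambda>i. n - i) ` {b..n - a}"
    proof
      fix i assume "i \<in> {a..n - b}"
      then show "i \<in> (\<lambda>i. n - i) ` {b..n - a}" by (intro image_eqI [of _ _ "n - i"]) auto
    qed
  qed auto
  have "(f \<otimes>\<^bsub>L\<^esub> g) n = (\<Oplus>i\<in>(\<lambda>i. n - i) ` {b..n - a}. f i \<otimes> g (n - i))"
    unfolding im by (rule mult_coeff_interval [OF ab])
  also have "\<dots> = (\<Oplus>i\<in>{b..n - a}. f (n - i) \<otimes> g (n - (n - i)))"
    by (rule finsum_reindex) (use ab ord_ge_coeff in \<open>auto simp: inj_on_def\<close>)
  also have "\<dots> = (\<Oplus>i\<in>{b..n - a}. g i \<otimes> f (n - i))"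
    by (rule finsum_cong') (use ab ord_ge_coeff in \<open>auto simp: m_comm\<close>)
  also have "\<dots> = (g \<otimes>\<^bsub>L\<^esub> f) n" by (rule mult_coeff_interval [OF ab(2,1), symmetric])
  finally show "(f \<otimes>\<^bsub>L\<^esub> g) n = (g \<otimes>\<^bsub>L\<^esub> f) n" .
qed

lemma L_mult_assoc:
  assumes "f \<in> carrier L" "g \<in> carrier L" "h \<in> carrier L"
  shows "(f \<otimes>\<^bsub>L\<^esub> g) \<otimes>\<^bsub>L\<^esub> h = f \<otimes>\<^bsub>L\<^esub> (g \<otimes>\<^bsub>L\<^esub> h)"
proof
  fix n
  obtain a b c where f: "f \<in> ord_ge a" and g: "g \<in> ord_ge b" and h: "h \<in> ord_ge c"
    using assms unfolding carrier_L by blast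
  have cl: "f i \<in> carrier R" "g i \<in> carrier R" "h i \<in> carrier R" for i
    using f g h ord_ge_coeff by blast+
  \<comment> \<open>Both sides are sums over the same rectangle of pairs \<open>(i, j)\<close>, where \<open>i\<close> is the exponent from
    \<open>f\<close> and \<open>j\<close> that from the product of \<open>f\<close> and \<open>g\<close>.\<close>
  let ?I = "{a..n - (b + c)}" and ?J = "{a + b..n - c}"
  have "((f \<otimes>\<^bsub>L\<^esub> g) \<otimes>\<^bsub>L\<^esub> h) n = (\<Oplus>j\<in>?J. (f \<otimes>\<^bsub>L\<^esub> g) j \<otimes> h (n - j))"
    by (rule mult_coeff_interval [OF ord_ge_mult [OF f g] h])
  also have "\<dots> = (\<Oplus>j\<in>?J. \<Oplus>i\<in>?I. f i \<otimes> (g (j - i) \<otimes> h (n - j)))"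
  proof (rule finsum_cong' [OF refl])
    fix j assume j: "j \<in> ?J"
    have "(f \<otimes>\<^bsub>L\<^esub> g) j = (\<Oplus>i\<in>?I. f i \<otimes> g (j - i))"
    proof (rule mult_coeff [OF assms(1,2)])
      fix i assume "i \<notin> ?I"
      then have "i < a \<or> j - i < b" using j by auto
      then show "f i = \<zero> \<or> g (j - i) = \<zero>" using f g by (auto simp: ord_ge_zero)
    qed simp
    then show "(f \<otimes>\<^bsub>L\<^esub> g) j \<otimes> h (n - j) = (\<Oplus>i\<in>?I. f i \<otimes> (g (j - i) \<otimes> h (n - j)))"
      using cl by (simp add: finsum_ldistr m_assoc)
  qed (use cl in auto)
  also have "\<dots> = (\<Oplus>i\<in>?I. \<Oplus>j\<in>?J. f i \<otimes> (g (j - i) \<otimes> h (n - j)))"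
    by (rule finsum_swap) (use cl in auto)
  also have "\<dots> = (\<Oplus>i\<in>?I. f i \<otimes> (g \<otimes>\<^bsub>L\<^esub> h) (n - i))"
  proof (rule finsum_cong' [OF refl])
    fix i assume i: "i \<in> ?I"
    have "(g \<otimes>\<^bsub>L\<^esub> h) (n - i) = (\<Oplus>k\<in>(\<lambda>j. j - i) ` ?J. g k \<otimes> h (n - i - k))"
    proof (rule mult_coeff [OF assms(2,3)])
      fix k assume "k \<notin> (\<lambda>j. j - i) ` ?J"
      then have "k + i \<notin> ?J" by (metis add_diff_cancel_right' image_eqI)
      then have "k < b \<or> n - i - k < c" using i by auto
      then show "g k = \<zero> \<or> h (n - i - k) = \<zero>" using g h by (auto simp: ord_ge_zero)
    qed simp
    also have "\<dots> = (\<Oplus>j\<in>?J. g (j - i) \<otimes> h (n - i - (j - i)))"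
      by (rule finsum_reindex) (use cl in \<open>auto simp: inj_on_def\<close>)
    finally show "(\<Oplus>j\<in>?J. f i \<otimes> (g (j - i) \<otimes> h (n - j))) = f i \<otimes> (g \<otimes>\<^bsub>L\<^esub> h) (n - i)"
      using cl by (simp add: finsum_rdistr)
  qed (use cl ord_ge_mult [OF g h] ord_ge_coeff in auto)
  also have "\<dots> = (f \<otimes>\<^bsub>L\<^esub> (g \<otimes>\<^bsub>L\<^esub> h)) n"
    by (rule mult_coeff_interval [OF f ord_ge_mult [OF g h], symmetric])
  finally show "((f \<otimes>\<^bsub>L\<^esub> g) \<otimes>\<^bsub>L\<^esub> h) n = (f \<otimes>\<^bsub>L\<^esub> (g \<otimes>\<^bsub>L\<^esub> h)) n" .
qed

text \<open>The monomial with exponent \<open>k\<close> and coefficient \<open>c\<close>.\<close>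

definition mon :: "int \<Rightarrow> 'a \<Rightarrow> int \<Rightarrow> 'a" where
  "mon k c = (\<lambda>i. if i = k then c else \<zero>)"

lemma mon_ord_ge: "c \<in> carrier R \<Longrightarrow> mon k c \<in> ord_ge k"
  by (auto simp: ord_ge_def mon_def)

lemma mon_mult:
  assumes "c \<in> carrier R" "f \<in> carrier L"
  shows "(mon k c \<otimes>\<^bsub>L\<^esub> f) n = c \<otimes> f (n - k)"
  using mult_coeff [of "mon k c" f "{k}" n] assms ord_ge_carrier [OF mon_ord_ge [OF assms(1)]]
  by (simp add: mon_def coeff_closed)

lemma L_one_mon: "\<one>\<^bsub>L\<^esub> = mon 0 \<one>"
  by (simp add: fun_eq_iff L_one mon_def)

lemma mon_mult_mon:
  assumes "c \<in> carrier R" "d \<in> carrier R"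
  shows "mon k c \<otimes>\<^bsub>L\<^esub> mon l d = mon (k + l) (c \<otimes> d)"
  using assms ord_ge_carrier [OF mon_ord_ge [OF assms(2)], of l]
  by (auto simp: fun_eq_iff mon_mult) (auto simp: mon_def)

lemma common_ord_ge:
  assumes "f \<in> carrier L" "g \<in> carrier L"
  obtains a where "f \<in> ord_ge a" "g \<in> ord_ge a"
proof -
  obtain a b where "f \<in> ord_ge a" "g \<in> ord_ge b" using assms unfolding carrier_L by blast
  then have "f \<in> ord_ge (min a b)" "g \<in> ord_ge (min a b)" by (auto intro: ord_ge_mono)
  then show thesis by (rule that)
qed

lemma L_cring: "cring L"
proof (rule cringI)
  show "abelian_group L"
  proof (rule abelian_groupI)
    show "f \<oplus>\<^bsub>L\<^esub> g \<in> carrier L" if "f \<in> carrier L" "g \<in> carrier L" for f g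
      using common_ord_ge [OF that] ord_ge_add ord_ge_carrier by metis
    show "\<zero>\<^bsub>L\<^esub> \<in> carrier L"
      by (rule ord_ge_carrier [of _ 0]) (auto simp: ord_ge_def L_zero)
    show "\<exists>g\<in>carrier L. g \<oplus>\<^bsub>L\<^esub> f = \<zero>\<^bsub>L\<^esub>" if f: "f \<in> carrier L" for f
    proof
      obtain a where "f \<in> ord_ge a" using f unfolding carrier_L by blast
      then have "(\<lambda>i. \<ominus> f i) \<in> ord_ge a" by (auto simp: ord_ge_def)
      then show "(\<lambda>i. \<ominus> f i) \<in> carrier L" by (rule ord_ge_carrier)
      show "(\<lambda>i. \<ominus> f i) \<oplus>\<^bsub>L\<^esub> f = \<zero>\<^bsub>L\<^esub>"
        using coeff_closed [OF f] by (auto simp: fun_eq_iff L_add L_zero l_neg)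
    qed
  qed (auto simp: fun_eq_iff L_add L_zero coeff_closed a_assoc intro: a_comm)
  show "comm_monoid L"
  proof (rule comm_monoidI)
    show "f \<otimes>\<^bsub>L\<^esub> g \<in> carrier L" if "f \<in> carrier L" "g \<in> carrier L" for f g
      using common_ord_ge [OF that] ord_ge_mult ord_ge_carrier by metis
    show "\<one>\<^bsub>L\<^esub> \<in> carrier L"
      unfolding L_one_mon by (rule ord_ge_carrier [OF mon_ord_ge]) simp
    show "\<one>\<^bsub>L\<^esub> \<otimes>\<^bsub>L\<^esub> f = f" if "f \<in> carrier L" for f
      unfolding L_one_mon using that by (simp add: fun_eq_iff mon_mult coeff_closed)
  qed (simp_all add: L_mult_assoc L_mult_comm)
  fix f g h assume *: "f \<in> carrier L" "g \<in> carrier L" "h \<in> carrier L"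
  show "(f \<oplus>\<^bsub>L\<^esub> g) \<otimes>\<^bsub>L\<^esub> h = f \<otimes>\<^bsub>L\<^esub> h \<oplus>\<^bsub>L\<^esub> g \<otimes>\<^bsub>L\<^esub> h"
  proof
    fix n
    obtain a where fg: "f \<in> ord_ge a" "g \<in> ord_ge a" by (rule common_ord_ge [OF *(1,2)])
    obtain b where h: "h \<in> ord_ge b" using *(3) unfolding carrier_L by blast
    show "((f \<oplus>\<^bsub>L\<^esub> g) \<otimes>\<^bsub>L\<^esub> h) n = (f \<otimes>\<^bsub>L\<^esub> h \<oplus>\<^bsub>L\<^esub> g \<otimes>\<^bsub>L\<^esub> h) n"
      using * unfolding L_add mult_coeff_interval [OF fg(1) h] mult_coeff_interval [OF fg(2) h]
        mult_coeff_interval [OF ord_ge_add [OF fg] h]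
      by (subst finsum_addf [symmetric]) (auto simp: coeff_closed l_distr intro!: finsum_cong')
  qed
qed

interpretation Ls: cring L by (rule L_cring)

lemma L_uminus: "f \<in> carrier L \<Longrightarrow> (\<ominus>\<^bsub>L\<^esub> f) i = \<ominus> f i"
proof -
  assume f: "f \<in> carrier L"
  have "f i \<oplus> (\<ominus>\<^bsub>L\<^esub> f) i = (f \<oplus>\<^bsub>L\<^esub> \<ominus>\<^bsub>L\<^esub> f) i" by (simp add: L_add)
  also have "\<dots> = \<zero>" using f by (simp add: Ls.r_neg L_zero)
  finally show ?thesis
    using f by (metis Ls.a_inv_closed a_comm coeff_closed minus_equality)
qed

lemma L_minus: "f \<in> carrier L \<Longrightarrow> g \<in> carrier L \<Longrightarrow> (f \<ominus>\<^bsub>L\<^esub> g) i = f i \<ominus> g i"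
  by (simp add: a_minus_def L_add L_uminus)

lemma ord_ge_uminus: "f \<in> ord_ge a \<Longrightarrow> \<ominus>\<^bsub>L\<^esub> f \<in> ord_ge a"
  using ord_ge_carrier by (intro ord_geI) (auto simp: L_uminus ord_ge_zero)

lemma ord_ge_minus: "f \<in> ord_ge a \<Longrightarrow> g \<in> ord_ge a \<Longrightarrow> f \<ominus>\<^bsub>L\<^esub> g \<in> ord_ge a"
  unfolding a_minus_def by (intro ord_ge_add ord_ge_uminus)

lemma ord_ge_minus_iff:
  assumes "f \<in> carrier L" "g \<in> carrier L"
  shows "f \<ominus>\<^bsub>L\<^esub> g \<in> ord_ge n \<longleftrightarrow> (\<forall>i<n. f i = g i)"
proof -
  have "f \<ominus>\<^bsub>L\<^esub> g \<in> ord_ge n \<longleftrightarrow> (\<forall>i<n. f i \<ominus> g i = \<zero>)"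
    using assms ord_geI [of "f \<ominus>\<^bsub>L\<^esub> g" n] ord_ge_zero [of "f \<ominus>\<^bsub>L\<^esub> g" n] by (auto simp: L_minus)
  then show ?thesis using assms by (simp add: coeff_closed)
qed

lemma L_one_ord_ge: "\<one>\<^bsub>L\<^esub> \<in> ord_ge 0"
  unfolding L_one_mon by (rule mon_ord_ge) simp

lemma ord_ge_pow: "f \<in> ord_ge 0 \<Longrightarrow> f [^]\<^bsub>L\<^esub> (k::nat) \<in> ord_ge 0 \<and> (f [^]\<^bsub>L\<^esub> k) 0 = f 0 [^] k"
proof (induction k)
  case 0
  show ?case using L_one_ord_ge by (simp add: L_one [of 0])
next
  case (Suc k)
  then show ?case
    using ord_ge_mult [of "f [^]\<^bsub>L\<^esub> k" 0 f 0] lowest_coeff_mult [of "f [^]\<^bsub>L\<^esub> k" 0 f 0] by simp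
qed

lemma L_add_pow: "f \<in> carrier L \<Longrightarrow> (add_pow L (k::nat) f) i = add_pow R k (f i)"
  by (induction k) (simp_all add: L_zero L_add Ls.add.nat_pow_Suc add.nat_pow_Suc)

lemma L_char: "add_pow R (p::nat) \<one> = \<zero> \<Longrightarrow> add_pow L p \<one>\<^bsub>L\<^esub> = \<zero>\<^bsub>L\<^esub>"
  by (simp add: fun_eq_iff L_add_pow L_one L_zero)

text \<open>
  Banach's fixed point theorem for power series with a given constant term: a map that improves
  the agreement of any two series by one coefficient has a fixed point.
\<close>

lemma power_series_fixpoint:
  assumes c: "c \<in> carrier R"
    and closed: "\<And>y. y \<in> ord_ge 0 \<Longrightarrow> y 0 = c \<Longrightarrow> F y \<in> ord_ge 0 \<and> F y 0 = c"
    and contract: "\<And>y y' n. \<lbrakk>y \<in> ord_ge 0; y' \<in> ord_ge 0; y 0 = c; y' 0 = c; n \<ge> 1;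
        y \<ominus>\<^bsub>L\<^esub> y' \<in> ord_ge n\<rbrakk> \<Longrightarrow> F y \<ominus>\<^bsub>L\<^esub> F y' \<in> ord_ge (n + 1)"
  obtains y where "y \<in> ord_ge 0" "y 0 = c" "F y = y"
proof -
  define z where "z k = (F ^^ k) (mon 0 c)" for k
  have z: "z k \<in> ord_ge 0 \<and> z k 0 = c" for k
  proof (induction k)
    case 0
    show ?case using mon_ord_ge [OF c, of 0] by (simp add: z_def mon_def)
  qed (use closed in \<open>simp add: z_def\<close>)
  have F_z: "F (z k) = z (Suc k)" for k by (simp add: z_def)
  have agree: "\<forall>i < int k + 1. F y i = F y' i"
    if "y \<in> ord_ge 0" "y' \<in> ord_ge 0" "y 0 = c" "y' 0 = c" "\<forall>i < int k. y i = y' i" "k \<ge> 1" for y y' k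
  proof -
    have "y \<ominus>\<^bsub>L\<^esub> y' \<in> ord_ge (int k)"
      using that(5) by (simp add: ord_ge_minus_iff ord_ge_carrier [OF that(1)] ord_ge_carrier [OF that(2)])
    then have "F y \<ominus>\<^bsub>L\<^esub> F y' \<in> ord_ge (int k + 1)"
      using contract [OF that(1-4), of "int k"] that(6) by simp
    moreover have "F y \<in> carrier L" "F y' \<in> carrier L"
      using closed [OF that(1,3)] closed [OF that(2,4)] ord_ge_carrier by blast+
    ultimately show ?thesis by (simp only: ord_ge_minus_iff)
  qed
  have step: "\<forall>i < int k + 1. z k i = z (Suc k) i" for k
  proof (induction k)
    case 0
    have "z 0 i = z 1 i" if "i < 1" for i :: int
      using that z [of 0] z [of 1] by (cases "i = 0") (auto simp: ord_ge_zero)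
    then show ?case by simp
  next
    case (Suc k)
    show ?case
      using agree [of "z k" "z (Suc k)" "Suc k"] z Suc by (simp add: F_z add.commute)
  qed
  have stable: "z (k + l) i = z k i" if "i < int k + 1" for k l i
  proof (induction l)
    case (Suc l)
    then show ?case using step [of "k + l"] that by simp
  qed simp
  define y where "y i = (if i < 0 then \<zero> else z (nat i) i)" for i
  have zy: "z k i = y i" if "i < int k + 1" for k i
  proof (cases "i < 0")
    case True
    then show ?thesis using ord_ge_zero [OF conjunct1 [OF z]] by (simp add: y_def)
  next
    case False
    then have "k = nat i + (k - nat i)" using that by simp
    then show ?thesis using stable [of i "nat i" "k - nat i"] False by (simp add: y_def)
  qed
  have y: "y \<in> ord_ge 0" "y 0 = c"
    using z ord_ge_coeff [of _ 0] c by (auto simp: ord_ge_def y_def)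
  have "F y i = y i" for i
  proof -
    let ?k = "Suc (nat i)"
    have "F y i = F (z ?k) i"
      using agree [of y "z ?k" ?k] y z [of ?k] zy [of _ ?k] by simp
    also have "\<dots> = y i" unfolding F_z by (rule zy) simp
    finally show ?thesis .
  qed
  then have "F y = y" by (rule ext)
  with y show thesis by (rule that)
qed

end

context field
begin

interpretation Ls: cring L by (rule L_cring)

text \<open>
  With \<open>C\<close> the constant term of \<open>u\<close> and \<open>w\<close> the rest, the inverse \<open>y\<close> is the fixed point of
  \<open>y \<mapsto> (1 - w y) / C\<close>.
\<close>

lemma unit_power_series_inverse:
  assumes u: "u \<in> ord_ge 0" "u 0 \<noteq> \<zero>"
  shows "\<exists>y\<in>ord_ge 0. u \<otimes>\<^bsub>L\<^esub> y = \<one>\<^bsub>L\<^esub>"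
proof -
  let ?c = "u 0"
  have c: "?c \<in> carrier R" using u(1) by (rule ord_ge_coeff)
  have ic: "inv ?c \<in> carrier R" "?c \<otimes> inv ?c = \<one>" using c u(2) by (auto simp: field_Units)
  define C where "C = mon 0 ?c"
  define D where "D = mon 0 (inv ?c)"
  define w where "w = u \<ominus>\<^bsub>L\<^esub> C"
  have C: "C \<in> ord_ge 0" and D: "D \<in> ord_ge 0"
    using mon_ord_ge c ic(1) by (auto simp: C_def D_def)
  have [simp]: "u \<in> carrier L" "C \<in> carrier L" "D \<in> carrier L"
    using u(1) C D ord_ge_carrier by auto
  have w: "w \<in> ord_ge 1"
  proof -
    have "u i = C i" if "i < 1" for i
      using that ord_ge_zero [OF u(1), of i] by (auto simp: C_def mon_def)
    then show ?thesis unfolding w_def by (simp add: ord_ge_minus_iff)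
  qed
  then have [simp]: "w \<in> carrier L" by (rule ord_ge_carrier)
  have DC: "C \<otimes>\<^bsub>L\<^esub> D = \<one>\<^bsub>L\<^esub>"
    unfolding C_def D_def L_one_mon using c ic by (simp add: mon_mult_mon)
  let ?F = "\<lambda>y. D \<otimes>\<^bsub>L\<^esub> (\<one>\<^bsub>L\<^esub> \<ominus>\<^bsub>L\<^esub> w \<otimes>\<^bsub>L\<^esub> y)"
  obtain y where y: "y \<in> ord_ge 0" "?F y = y"
  proof (rule power_series_fixpoint [OF ic(1), of ?F])
    fix y assume y: "y \<in> ord_ge 0"
    have wy: "w \<otimes>\<^bsub>L\<^esub> y \<in> ord_ge 1" using ord_ge_mult [OF w y] by simp
    then have 1: "\<one>\<^bsub>L\<^esub> \<ominus>\<^bsub>L\<^esub> w \<otimes>\<^bsub>L\<^esub> y \<in> ord_ge 0"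
      by (intro ord_ge_minus L_one_ord_ge) (rule ord_ge_mono, auto)
    have "(\<one>\<^bsub>L\<^esub> \<ominus>\<^bsub>L\<^esub> w \<otimes>\<^bsub>L\<^esub> y) 0 = \<one>"
      using L_minus [OF Ls.one_closed ord_ge_carrier [OF wy], of 0] ord_ge_zero [OF wy, of 0]
      by (simp add: L_one [of 0] a_minus_def [of R])
    then show "?F y \<in> ord_ge 0 \<and> ?F y 0 = inv ?c"
      using ord_ge_mult [OF D 1] lowest_coeff_mult [OF D 1] ic by (simp add: D_def mon_def)
  next
    fix y y' n assume "y \<in> ord_ge 0" "y' \<in> ord_ge 0" and d: "y \<ominus>\<^bsub>L\<^esub> y' \<in> ord_ge n"
    then have yc: "y \<in> carrier L" "y' \<in> carrier L" using ord_ge_carrier by auto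
    have 1: "\<one>\<^bsub>L\<^esub> \<ominus>\<^bsub>L\<^esub> \<one>\<^bsub>L\<^esub> \<in> ord_ge (n + 1)" by (simp add: ord_ge_minus_iff)
    have 2: "w \<otimes>\<^bsub>L\<^esub> (y \<ominus>\<^bsub>L\<^esub> y') \<in> ord_ge (n + 1)"
      using ord_ge_mult [OF w d] by (simp add: add.commute)
    from ord_ge_mult [OF D ord_ge_minus [OF 1 2]] show "?F y \<ominus>\<^bsub>L\<^esub> ?F y' \<in> ord_ge (n + 1)"
      using yc by (simp add: Ls.affine_diff)
  qed
  have yc: "y \<in> carrier L" using y(1) by (rule ord_ge_carrier)
  have "C \<otimes>\<^bsub>L\<^esub> y = (C \<otimes>\<^bsub>L\<^esub> D) \<otimes>\<^bsub>L\<^esub> (\<one>\<^bsub>L\<^esub> \<ominus>\<^bsub>L\<^esub> w \<otimes>\<^bsub>L\<^esub> y)"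
    using yc by (subst y(2) [symmetric]) (simp add: Ls.m_assoc)
  then have "C \<otimes>\<^bsub>L\<^esub> y = \<one>\<^bsub>L\<^esub> \<ominus>\<^bsub>L\<^esub> w \<otimes>\<^bsub>L\<^esub> y" using yc by (simp add: DC)
  moreover have "u = C \<oplus>\<^bsub>L\<^esub> w" unfolding w_def by (simp add: Ls.add_minus_cancel)
  ultimately have "u \<otimes>\<^bsub>L\<^esub> y = (\<one>\<^bsub>L\<^esub> \<ominus>\<^bsub>L\<^esub> w \<otimes>\<^bsub>L\<^esub> y) \<oplus>\<^bsub>L\<^esub> w \<otimes>\<^bsub>L\<^esub> y"
    using yc by (simp add: Ls.l_distr)
  also have "\<dots> = \<one>\<^bsub>L\<^esub>" using yc by (simp add: a_minus_def Ls.a_assoc Ls.l_neg)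
  finally show ?thesis using y(1) by blast
qed

lemma exists_order:
  assumes "f \<in> carrier L" "f \<noteq> \<zero>\<^bsub>L\<^esub>"
  obtains a where "f \<in> ord_ge a" "f a \<noteq> \<zero>"
proof -
  obtain b where b: "f \<in> ord_ge b" using assms(1) unfolding carrier_L by blast
  obtain k where k: "f k \<noteq> \<zero>" using assms(2) by (auto simp: fun_eq_iff L_zero)
  then have "b \<le> k" using ord_ge_zero [OF b, of k] by force
  define j where "j = (LEAST j::nat. f (b + int j) \<noteq> \<zero>)"
  have "f (b + int (nat (k - b))) \<noteq> \<zero>" using k \<open>b \<le> k\<close> by simp
  then have j: "f (b + int j) \<noteq> \<zero>" unfolding j_def by (rule LeastI)
  have "f i = \<zero>" if "i < b + int j" for i
  proof (cases "i < b")
    case False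
    then have "nat (i - b) < j" using that by auto
    from not_less_Least [OF this [unfolded j_def]] show ?thesis using False by simp
  qed (rule ord_ge_zero [OF b])
  then have "f \<in> ord_ge (b + int j)" using assms(1) by (intro ord_geI)
  with j show thesis by (intro that)
qed

lemma inverse_order:
  assumes f: "f \<in> ord_ge a" "f a \<noteq> \<zero>"
  obtains g where "g \<in> ord_ge (- a)" "f \<otimes>\<^bsub>L\<^esub> g = \<one>\<^bsub>L\<^esub>" "f a \<otimes> g (- a) = \<one>"
proof -
  let ?s = "mon (- a) \<one>"
  have s: "?s \<in> ord_ge (- a)" by (rule mon_ord_ge) simp
  have "f \<otimes>\<^bsub>L\<^esub> ?s \<in> ord_ge 0" using ord_ge_mult [OF f(1) s] by simp
  moreover have "(f \<otimes>\<^bsub>L\<^esub> ?s) 0 \<noteq> \<zero>"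
    using lowest_coeff_mult [OF f(1) s] f(2) ord_ge_coeff [OF f(1)] by (simp add: mon_def)
  ultimately obtain y where y: "y \<in> ord_ge 0" "(f \<otimes>\<^bsub>L\<^esub> ?s) \<otimes>\<^bsub>L\<^esub> y = \<one>\<^bsub>L\<^esub>"
    using unit_power_series_inverse by blast
  show thesis
  proof (rule that)
    show g: "?s \<otimes>\<^bsub>L\<^esub> y \<in> ord_ge (- a)" using ord_ge_mult [OF s y(1)] by simp
    show fg: "f \<otimes>\<^bsub>L\<^esub> (?s \<otimes>\<^bsub>L\<^esub> y) = \<one>\<^bsub>L\<^esub>"
      using y f(1) s ord_ge_carrier by (simp flip: Ls.m_assoc)
    show "f a \<otimes> (?s \<otimes>\<^bsub>L\<^esub> y) (- a) = \<one>"
      using lowest_coeff_mult [OF f(1) g] fg by (simp add: L_one)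
  qed
qed

lemma L_field: "field L"
proof (rule Ls.cring_fieldI2)
  show "\<zero>\<^bsub>L\<^esub> \<noteq> \<one>\<^bsub>L\<^esub>"
    using L_one [of 0] L_zero [of 0] by auto
  fix f assume f: "f \<in> carrier L" "f \<noteq> \<zero>\<^bsub>L\<^esub>"
  obtain a where a: "f \<in> ord_ge a" "f a \<noteq> \<zero>" by (rule exists_order [OF f])
  obtain g where "g \<in> ord_ge (- a)" "f \<otimes>\<^bsub>L\<^esub> g = \<one>\<^bsub>L\<^esub>" by (rule inverse_order [OF a])
  then show "\<exists>g\<in>carrier L. f \<otimes>\<^bsub>L\<^esub> g = \<one>\<^bsub>L\<^esub>" using ord_ge_carrier by blast
qed

end

section \<open>The valuation ring of the field of Laurent series\<close>

lemma (in cring) minus_add_cancel: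
  assumes "x \<in> carrier R" "y \<in> carrier R"
  shows "(y \<oplus> x) \<ominus> y = x"
  using assms by algebra

context field
begin

interpretation Ls: field L by (rule L_field)

text \<open>
  Hensel's lemma for \<open>m\<close>-th roots, where \<open>m + 1\<close> is a power \<open>Q\<close> of the characteristic. The equation
  \<open>y\<^sup>m = u\<close> becomes \<open>y\<^sup>Q = u y\<close>, in which \<open>y\<^sup>Q\<close> is additive in \<open>y\<close>, so that its solution \<open>y\<close> with
  constant term \<open>c\<close> is found as a fixed point.
\<close>

lemma power_series_root:
  assumes p: "Factorial_Ring.prime p" "add_pow R (p::nat) \<one> = \<zero>" "Suc m = p ^ e" "m \<ge> 2"
    and u: "u \<in> ord_ge 0" and c: "c \<in> carrier R" "c \<noteq> \<zero>" "c [^] m = u 0"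
  shows "\<exists>y\<in>ord_ge 0. y 0 = c \<and> y [^]\<^bsub>L\<^esub> m = u"
proof -
  let ?Q = "Suc m"
  let ?w = "u 0"
  have w: "?w \<in> carrier R" "?w \<noteq> \<zero>"
  proof -
    show "?w \<in> carrier R" using u by (rule ord_ge_coeff)
    have "c [^] k \<noteq> \<zero>" for k :: nat using c by (induction k) (auto simp: integral_iff)
    from this [of m] show "?w \<noteq> \<zero>" using c(3) by simp
  qed
  have iw: "inv ?w \<in> carrier R" "?w \<otimes> inv ?w = \<one>" using w by (auto simp: field_Units)
  define C where "C = mon 0 ?w"
  define D where "D = mon 0 (inv ?w)"
  define v where "v = u \<ominus>\<^bsub>L\<^esub> C"
  have C: "C \<in> ord_ge 0" and D: "D \<in> ord_ge 0"
    using mon_ord_ge w iw(1) by (auto simp: C_def D_def)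
  have [simp]: "u \<in> carrier L" "C \<in> carrier L" "D \<in> carrier L"
    using u C D ord_ge_carrier by auto
  have v: "v \<in> ord_ge 1"
  proof -
    have "u i = C i" if "i < 1" for i
      using that ord_ge_zero [OF u, of i] by (auto simp: C_def mon_def)
    then show ?thesis unfolding v_def by (simp add: ord_ge_minus_iff)
  qed
  then have [simp]: "v \<in> carrier L" by (rule ord_ge_carrier)
  have CD: "C \<otimes>\<^bsub>L\<^esub> D = \<one>\<^bsub>L\<^esub>"
    unfolding C_def D_def L_one_mon using w iw by (simp add: mon_mult_mon)
  let ?F = "\<lambda>y. D \<otimes>\<^bsub>L\<^esub> (y [^]\<^bsub>L\<^esub> ?Q \<ominus>\<^bsub>L\<^esub> v \<otimes>\<^bsub>L\<^esub> y)"
  obtain y where y: "y \<in> ord_ge 0" "y 0 = c" "?F y = y"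
  proof (rule power_series_fixpoint [OF c(1), of ?F])
    fix y assume y: "y \<in> ord_ge 0" "y 0 = c"
    have vy: "v \<otimes>\<^bsub>L\<^esub> y \<in> ord_ge 1" using ord_ge_mult [OF v y(1)] by simp
    have yQ: "y [^]\<^bsub>L\<^esub> ?Q \<in> ord_ge 0" "(y [^]\<^bsub>L\<^esub> ?Q) 0 = c [^] ?Q"
      using ord_ge_pow [OF y(1), of ?Q] y(2) by simp_all
    have 1: "y [^]\<^bsub>L\<^esub> ?Q \<ominus>\<^bsub>L\<^esub> v \<otimes>\<^bsub>L\<^esub> y \<in> ord_ge 0"
      by (rule ord_ge_minus [OF yQ(1) ord_ge_mono [OF vy]]) simp
    have "(y [^]\<^bsub>L\<^esub> ?Q \<ominus>\<^bsub>L\<^esub> v \<otimes>\<^bsub>L\<^esub> y) 0 = ?w \<otimes> c"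
      using L_minus [OF ord_ge_carrier [OF yQ(1)] ord_ge_carrier [OF vy], of 0]
        ord_ge_zero [OF vy, of 0] yQ(2) c w(1)
      by (simp add: a_minus_def [of R])
    then have "?F y 0 = inv ?w \<otimes> (?w \<otimes> c)"
      using lowest_coeff_mult [OF D 1] by (simp add: D_def mon_def)
    also have "\<dots> = (?w \<otimes> inv ?w) \<otimes> c" using iw(1) w(1) c(1) by (simp add: m_ac)
    also have "\<dots> = c" using iw(2) c(1) by simp
    finally show "?F y \<in> ord_ge 0 \<and> ?F y 0 = c" using ord_ge_mult [OF D 1] by simp
  next
    fix y y' n assume yy: "y \<in> ord_ge 0" "y' \<in> ord_ge 0" and n: "n \<ge> 1" and d: "y \<ominus>\<^bsub>L\<^esub> y' \<in> ord_ge n"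
    then have yc: "y \<in> carrier L" "y' \<in> carrier L" using ord_ge_carrier by auto
    let ?d = "y \<ominus>\<^bsub>L\<^esub> y'"
    have d0: "?d \<in> ord_ge 0" by (rule ord_ge_mono [OF d]) (use n in simp)
    obtain j where j: "m = Suc j" using p(4) by (cases m) auto
    \<comment> \<open>By additivity of the Frobenius map, the difference of the powers is a power of order at
      least \<open>2 * n\<close>.\<close>
    have "y [^]\<^bsub>L\<^esub> ?Q \<ominus>\<^bsub>L\<^esub> y' [^]\<^bsub>L\<^esub> ?Q = ?d [^]\<^bsub>L\<^esub> ?Q"
      unfolding p(3) by (rule Ls.frobenius_power_minus [OF p(1) L_char [OF p(2)] yc, symmetric])
    also have "\<dots> = ?d [^]\<^bsub>L\<^esub> j \<otimes>\<^bsub>L\<^esub> ?d \<otimes>\<^bsub>L\<^esub> ?d" by (simp add: j)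
    also have "\<dots> \<in> ord_ge (0 + n + n)"
      by (intro ord_ge_mult d conjunct1 [OF ord_ge_pow [OF d0]])
    finally have 1: "y [^]\<^bsub>L\<^esub> ?Q \<ominus>\<^bsub>L\<^esub> y' [^]\<^bsub>L\<^esub> ?Q \<in> ord_ge (n + 1)"
      by (rule ord_ge_mono) (use n in simp)
    have 2: "v \<otimes>\<^bsub>L\<^esub> ?d \<in> ord_ge (n + 1)"
      using ord_ge_mult [OF v d] by (simp add: add.commute)
    have "?F y \<ominus>\<^bsub>L\<^esub> ?F y' = D \<otimes>\<^bsub>L\<^esub> ((y [^]\<^bsub>L\<^esub> ?Q \<ominus>\<^bsub>L\<^esub> y' [^]\<^bsub>L\<^esub> ?Q) \<ominus>\<^bsub>L\<^esub> v \<otimes>\<^bsub>L\<^esub> ?d)"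
      by (rule Ls.affine_diff) (use yc in simp_all)
    with ord_ge_mult [OF D ord_ge_minus [OF 1 2]] show "?F y \<ominus>\<^bsub>L\<^esub> ?F y' \<in> ord_ge (n + 1)"
      by simp
  qed
  have yc: "y \<in> carrier L" using y(1) by (rule ord_ge_carrier)
  let ?A = "y [^]\<^bsub>L\<^esub> ?Q \<ominus>\<^bsub>L\<^esub> v \<otimes>\<^bsub>L\<^esub> y"
  have A: "?A \<in> carrier L" "y [^]\<^bsub>L\<^esub> ?Q \<in> carrier L" "v \<otimes>\<^bsub>L\<^esub> y \<in> carrier L"
    using yc by (auto simp del: Ls.nat_pow_Suc)
  have "C \<otimes>\<^bsub>L\<^esub> y = C \<otimes>\<^bsub>L\<^esub> (D \<otimes>\<^bsub>L\<^esub> ?A)" by (simp only: y(3))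
  also have "\<dots> = (C \<otimes>\<^bsub>L\<^esub> D) \<otimes>\<^bsub>L\<^esub> ?A" by (rule Ls.m_assoc [symmetric]) (use A in simp_all)
  finally have "C \<otimes>\<^bsub>L\<^esub> y = ?A" using Ls.l_one [OF A(1)] by (simp only: CD)
  moreover have "u = C \<oplus>\<^bsub>L\<^esub> v" unfolding v_def by (simp add: Ls.add_minus_cancel)
  ultimately have "u \<otimes>\<^bsub>L\<^esub> y = ?A \<oplus>\<^bsub>L\<^esub> v \<otimes>\<^bsub>L\<^esub> y"
    using Ls.l_distr [of C v y] yc by simp
  also have "\<dots> = y [^]\<^bsub>L\<^esub> ?Q"
    using Ls.add_minus_cancel [OF A(2,3)] Ls.a_comm [OF A(1,3)] by (simp only:)
  also have "\<dots> = y [^]\<^bsub>L\<^esub> m \<otimes>\<^bsub>L\<^esub> y" by (rule Ls.nat_pow_Suc)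
  finally have eq: "u \<otimes>\<^bsub>L\<^esub> y = y [^]\<^bsub>L\<^esub> m \<otimes>\<^bsub>L\<^esub> y" .
  have "y \<noteq> \<zero>\<^bsub>L\<^esub>" using y(2) c(2) L_zero [of 0] by auto
  from Ls.m_rcancel [OF this yc, of u "y [^]\<^bsub>L\<^esub> m"] eq yc have "u = y [^]\<^bsub>L\<^esub> m" by simp
  with y show ?thesis by blast
qed

text \<open>
  The base case: a coefficient field all of whose nonzero elements are \<open>m\<close>-th roots of unity, such
  as a finite one for suitable \<open>m\<close>. The valuation ring consists of the power series.
\<close>

lemma henselian_valuation_power_series:
  assumes p: "Factorial_Ring.prime p" "add_pow R (p::nat) \<one> = \<zero>" "Suc m = p ^ e" "m \<ge> 2"
    and roots: "\<And>x. x \<in> carrier R \<Longrightarrow> x \<noteq> \<zero> \<Longrightarrow> x [^] m = \<one>"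
  shows "henselian_valuation L (ord_ge 0) (mon 1 \<one>) p m e"
proof (intro henselian_valuation.intro henselian_valuation_axioms.intro L_field)
  let ?t = "mon 1 \<one>" and ?s = "mon (- 1) \<one>"
  have t: "?t \<in> ord_ge 1" and s: "?s \<in> ord_ge (- 1)" by (simp_all add: mon_ord_ge)
  have tc: "?t \<in> carrier L" "?s \<in> carrier L" using t s ord_ge_carrier by auto
  have ts: "?t \<otimes>\<^bsub>L\<^esub> ?s = \<one>\<^bsub>L\<^esub>" by (simp add: mon_mult_mon L_one_mon)
  have tsx: "?t \<otimes>\<^bsub>L\<^esub> (?s \<otimes>\<^bsub>L\<^esub> x) = x" if "x \<in> carrier L" for x
    using that tc by (simp flip: Ls.m_assoc add: ts)
  have divide: "?s \<otimes>\<^bsub>L\<^esub> x \<in> ord_ge 0" if "x \<in> ord_ge 1" for x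
    using ord_ge_mult [OF s that] by simp
  show "subring (ord_ge 0) L"
  proof (rule Ls.subringI)
    show "f \<otimes>\<^bsub>L\<^esub> g \<in> ord_ge 0" if "f \<in> ord_ge 0" "g \<in> ord_ge 0" for f g
      using ord_ge_mult [OF that] by simp
  qed (auto intro: ord_ge_carrier L_one_ord_ge ord_ge_uminus ord_ge_add)
  show t0: "?t \<in> ord_ge 0" using t by (rule ord_ge_mono) simp
  show "?t \<noteq> \<zero>\<^bsub>L\<^esub>"
  proof
    assume "?t = \<zero>\<^bsub>L\<^esub>"
    then have "?t 1 = \<zero>" by (simp only: L_zero)
    then show False by (simp add: mon_def)
  qed
  show "?t \<otimes>\<^bsub>L\<^esub> r \<noteq> \<one>\<^bsub>L\<^esub>" if "r \<in> ord_ge 0" for r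
    using ord_ge_zero [OF ord_ge_mult [OF t that], of 0] L_one [of 0] by auto
  show "\<exists>r\<in>ord_ge 0. f \<otimes>\<^bsub>L\<^esub> (?t \<otimes>\<^bsub>L\<^esub> r) = \<one>\<^bsub>L\<^esub>" if f: "f \<in> carrier L" "f \<notin> ord_ge 0" for f
  proof -
    have "f \<noteq> \<zero>\<^bsub>L\<^esub>" using f(2) ord_geI [OF f(1), of 0] L_zero by metis
    then obtain a where a: "f \<in> ord_ge a" "f a \<noteq> \<zero>" by (rule exists_order [OF f(1)])
    then have "a < 0" using f(2) ord_ge_mono [OF a(1), of 0] by force
    obtain g where g: "g \<in> ord_ge (- a)" "f \<otimes>\<^bsub>L\<^esub> g = \<one>\<^bsub>L\<^esub>" by (rule inverse_order [OF a])
    then have "g \<in> ord_ge 1" using \<open>a < 0\<close> by (auto intro: ord_ge_mono)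
    then show ?thesis
      using divide [of g] g(2) by (intro bexI [of _ "?s \<otimes>\<^bsub>L\<^esub> g"]) (simp_all add: tsx ord_ge_carrier)
  qed
  show "(\<exists>r\<in>ord_ge 0. f = ?t \<otimes>\<^bsub>L\<^esub> r) \<or> (\<exists>r\<in>ord_ge 0. f [^]\<^bsub>L\<^esub> m = \<one>\<^bsub>L\<^esub> \<oplus>\<^bsub>L\<^esub> ?t \<otimes>\<^bsub>L\<^esub> r)"
    if f: "f \<in> ord_ge 0" for f
  proof (cases "f 0 = \<zero>")
    case True
    have "f i = \<zero>" if "i < 1" for i
      using True ord_ge_zero [OF f, of i] that by (cases "i = 0") auto
    then have "f \<in> ord_ge 1" by (rule ord_geI [OF ord_ge_carrier [OF f]])
    then show ?thesis
      using divide [of f] tsx [OF ord_ge_carrier [OF f]] by (intro disjI1 bexI [of _ "?s \<otimes>\<^bsub>L\<^esub> f"]) simp_all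
  next
    case False
    let ?g = "f [^]\<^bsub>L\<^esub> m \<ominus>\<^bsub>L\<^esub> \<one>\<^bsub>L\<^esub>"
    have fm: "f [^]\<^bsub>L\<^esub> m \<in> ord_ge 0" "(f [^]\<^bsub>L\<^esub> m) 0 = \<one>"
      using ord_ge_pow [OF f, of m] roots [OF ord_ge_coeff [OF f] False] by simp_all
    have fc: "f [^]\<^bsub>L\<^esub> m \<in> carrier L" by (rule ord_ge_carrier [OF fm(1)])
    have "(f [^]\<^bsub>L\<^esub> m) i = \<one>\<^bsub>L\<^esub> i" if "i < 1" for i
      using that fm(2) ord_ge_zero [OF fm(1), of i] L_one [of i] by (cases "i = 0") auto
    then have g: "?g \<in> ord_ge 1" using fc by (simp add: ord_ge_minus_iff)
    have "f [^]\<^bsub>L\<^esub> m = \<one>\<^bsub>L\<^esub> \<oplus>\<^bsub>L\<^esub> ?g" using fc by (simp add: Ls.add_minus_cancel)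
    then show ?thesis
      using divide [OF g] tsx [OF ord_ge_carrier [OF g]]
      by (intro disjI2 bexI [of _ "?s \<otimes>\<^bsub>L\<^esub> ?g"]) simp_all
  qed
  show "\<exists>y\<in>ord_ge 0. y [^]\<^bsub>L\<^esub> m = \<one>\<^bsub>L\<^esub> \<oplus>\<^bsub>L\<^esub> ?t \<otimes>\<^bsub>L\<^esub> r" if r: "r \<in> ord_ge 0" for r
  proof -
    let ?u = "\<one>\<^bsub>L\<^esub> \<oplus>\<^bsub>L\<^esub> ?t \<otimes>\<^bsub>L\<^esub> r"
    have tr: "?t \<otimes>\<^bsub>L\<^esub> r \<in> ord_ge 1" using ord_ge_mult [OF t r] by simp
    have u: "?u \<in> ord_ge 0" by (rule ord_ge_add [OF L_one_ord_ge ord_ge_mono [OF tr]]) simp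
    have "?u 0 = \<one>" using L_add [of "\<one>\<^bsub>L\<^esub>" _ 0] ord_ge_zero [OF tr, of 0] L_one [of 0] by simp
    then have "\<one> [^] m = ?u 0" by simp
    from power_series_root [OF p u one_closed one_not_zero this] show ?thesis by blast
  qed
  show "add_pow L p \<one>\<^bsub>L\<^esub> = \<zero>\<^bsub>L\<^esub>" by (rule L_char [OF p(2)])
qed (use p in auto)

end

context henselian_valuation
begin

interpretation Ls: field L by (rule L_field)

text \<open>
  The induction step: the order of a series is refined by the valuation of its lowest coefficient.
  The valuation ring consists of the power series whose constant term lies in \<open>V\<close>, and its maximal
  ideal is still generated by \<open>t\<close>.
\<close>

definition V_L :: "(int \<Rightarrow> 'a) set" where
  "V_L = {f \<in> ord_ge 0. f 0 \<in> V}"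

lemma henselian_valuation_L: "henselian_valuation L V_L (mon 0 t) p m e"
proof (intro henselian_valuation.intro henselian_valuation_axioms.intro L_field)
  have it: "inv t \<in> carrier R" "t \<otimes> inv t = \<one>"
    using t_nonzero by (auto simp: field_Units)
  let ?t = "mon 0 t" and ?s = "mon 0 (inv t)"
  have t: "?t \<in> ord_ge 0" and s: "?s \<in> ord_ge 0" using it by (simp_all add: mon_ord_ge)
  have tc: "?t \<in> carrier L" "?s \<in> carrier L" using t s ord_ge_carrier by auto
  have ts: "?t \<otimes>\<^bsub>L\<^esub> ?s = \<one>\<^bsub>L\<^esub>" using it by (simp add: mon_mult_mon L_one_mon)
  have tsx: "?t \<otimes>\<^bsub>L\<^esub> (?s \<otimes>\<^bsub>L\<^esub> x) = x" if "x \<in> carrier L" for x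
    using that tc by (simp flip: Ls.m_assoc add: ts)
  have divide: "?s \<otimes>\<^bsub>L\<^esub> x \<in> V_L" if "x \<in> ord_ge 0" "x 0 = t \<otimes> r" "r \<in> V" for x r
  proof -
    have "(?s \<otimes>\<^bsub>L\<^esub> x) 0 = inv t \<otimes> (t \<otimes> r)"
      using lowest_coeff_mult [OF s that(1)] that(2) by (simp add: mon_def)
    also have "\<dots> = (t \<otimes> inv t) \<otimes> r" using it(1) V_sub [OF that(3)] by (simp add: m_ac)
    also have "\<dots> = r" using it(2) V_sub [OF that(3)] by simp
    finally show ?thesis using ord_ge_mult [OF s that(1)] that(3) by (simp add: V_L_def)
  qed
  have V_LD: "f \<in> ord_ge 0" "f 0 \<in> V" "f \<in> carrier L" if "f \<in> V_L" for f
    using that ord_ge_carrier by (auto simp: V_L_def)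
  show "subring V_L L"
  proof (rule Ls.subringI)
    show "\<one>\<^bsub>L\<^esub> \<in> V_L" using L_one_ord_ge L_one [of 0] by (simp add: V_L_def)
    show "\<ominus>\<^bsub>L\<^esub> f \<in> V_L" if "f \<in> V_L" for f
      using V_LD [OF that] ord_ge_uminus by (simp add: V_L_def L_uminus)
    show "f \<otimes>\<^bsub>L\<^esub> g \<in> V_L" if "f \<in> V_L" "g \<in> V_L" for f g
      using ord_ge_mult [OF V_LD(1) V_LD(1), OF that] lowest_coeff_mult [OF V_LD(1) V_LD(1), OF that]
        V_LD(2) [OF that(1)] V_LD(2) [OF that(2)]
      by (simp add: V_L_def)
    show "f \<oplus>\<^bsub>L\<^esub> g \<in> V_L" if "f \<in> V_L" "g \<in> V_L" for f g
      using ord_ge_add [OF V_LD(1) V_LD(1), OF that] V_LD(2) [OF that(1)] V_LD(2) [OF that(2)]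
      by (simp add: V_L_def L_add)
  qed (use V_LD in blast)
  show "?t \<in> V_L" using t t_in by (simp add: V_L_def mon_def)
  show "?t \<noteq> \<zero>\<^bsub>L\<^esub>"
  proof
    assume "?t = \<zero>\<^bsub>L\<^esub>"
    then have "?t 0 = \<zero>" by (simp only: L_zero)
    then show False using t_nonzero by (simp add: mon_def)
  qed
  show "?t \<otimes>\<^bsub>L\<^esub> r \<noteq> \<one>\<^bsub>L\<^esub>" if "r \<in> V_L" for r
    using lowest_coeff_mult [OF t V_LD(1) [OF that]] t_nonunit [OF V_LD(2) [OF that]] L_one [of 0]
    by (auto simp: mon_def)
  show "\<exists>r\<in>V_L. f \<otimes>\<^bsub>L\<^esub> (?t \<otimes>\<^bsub>L\<^esub> r) = \<one>\<^bsub>L\<^esub>" if f: "f \<in> carrier L" "f \<notin> V_L" for f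
  proof -
    have "f \<noteq> \<zero>\<^bsub>L\<^esub>"
    proof
      assume "f = \<zero>\<^bsub>L\<^esub>"
      then have "f i = \<zero>" for i by (simp only: L_zero)
      then show False using f ord_geI [OF f(1), of 0] by (simp add: V_L_def)
    qed
    then obtain a where a: "f \<in> ord_ge a" "f a \<noteq> \<zero>" by (rule exists_order [OF f(1)])
    obtain g where g: "g \<in> ord_ge (- a)" "f \<otimes>\<^bsub>L\<^esub> g = \<one>\<^bsub>L\<^esub>" "f a \<otimes> g (- a) = \<one>"
      by (rule inverse_order [OF a])
    have "a \<le> 0"
    proof (rule ccontr)
      assume "\<not> a \<le> 0"
      then have "f 0 = \<zero>" "f \<in> ord_ge 0" using a(1) by (auto intro: ord_ge_zero ord_ge_mono)
      then show False using f(2) by (simp add: V_L_def)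
    qed
    then have g0: "g \<in> ord_ge 0" using g(1) by (auto intro: ord_ge_mono)
    have "\<exists>r\<in>V. g 0 = t \<otimes> r"
    proof (cases "a = 0")
      case False
      with \<open>a \<le> 0\<close> have "g 0 = t \<otimes> \<zero>" using ord_ge_zero [OF g(1), of 0] by simp
      then show ?thesis by (intro bexI [of _ \<zero>]) auto
    next
      case True
      have fg: "f 0 \<in> carrier R" "g 0 \<in> carrier R" using a(1) g(1) ord_ge_coeff by blast+
      have "f 0 \<notin> V" using f(2) a(1) True by (simp add: V_L_def)
      then obtain r where r: "r \<in> V" "f 0 \<otimes> (t \<otimes> r) = \<one>" using valuation [OF fg(1)] by blast
      have "f 0 \<otimes> g 0 = f 0 \<otimes> (t \<otimes> r)" using g(3) r(2) True by simp
      then have "g 0 = t \<otimes> r"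
        using m_lcancel [of "f 0" "g 0" "t \<otimes> r"] a(2) True fg V_sub [OF r(1)] by simp
      with r(1) show ?thesis by blast
    qed
    then show ?thesis
      using divide [OF g0] g(2) tsx [OF ord_ge_carrier [OF g0]]
      by (intro bexI [of _ "?s \<otimes>\<^bsub>L\<^esub> g"]) auto
  qed
  show "(\<exists>r\<in>V_L. f = ?t \<otimes>\<^bsub>L\<^esub> r) \<or> (\<exists>r\<in>V_L. f [^]\<^bsub>L\<^esub> m = \<one>\<^bsub>L\<^esub> \<oplus>\<^bsub>L\<^esub> ?t \<otimes>\<^bsub>L\<^esub> r)"
    if f: "f \<in> V_L" for f
    using residue [OF V_LD(2) [OF f]]
  proof
    assume "\<exists>r\<in>V. f 0 = t \<otimes> r"
    then show ?thesis
      using divide [OF V_LD(1) [OF f]] tsx [OF V_LD(3) [OF f]]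
      by (intro disjI1 bexI [of _ "?s \<otimes>\<^bsub>L\<^esub> f"]) auto
  next
    assume "\<exists>r\<in>V. f 0 [^] m = \<one> \<oplus> t \<otimes> r"
    then obtain r where r: "r \<in> V" "f 0 [^] m = \<one> \<oplus> t \<otimes> r" by blast
    let ?g = "f [^]\<^bsub>L\<^esub> m \<ominus>\<^bsub>L\<^esub> \<one>\<^bsub>L\<^esub>"
    have fm: "f [^]\<^bsub>L\<^esub> m \<in> ord_ge 0" "(f [^]\<^bsub>L\<^esub> m) 0 = \<one> \<oplus> t \<otimes> r"
      using ord_ge_pow [OF V_LD(1) [OF f], of m] r(2) by simp_all
    have fc: "f [^]\<^bsub>L\<^esub> m \<in> carrier L" by (rule ord_ge_carrier [OF fm(1)])
    have g: "?g \<in> ord_ge 0" by (rule ord_ge_minus [OF fm(1) L_one_ord_ge])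
    have "?g 0 = (\<one> \<oplus> t \<otimes> r) \<ominus> \<one>"
      using L_minus [OF fc Ls.one_closed, of 0] fm(2) L_one [of 0] by simp
    also have "\<dots> = t \<otimes> r"
      using V_sub [OF r(1)] by (simp add: minus_add_cancel)
    finally have "?s \<otimes>\<^bsub>L\<^esub> ?g \<in> V_L" using divide [OF g _ r(1)] by simp
    moreover have "f [^]\<^bsub>L\<^esub> m = \<one>\<^bsub>L\<^esub> \<oplus>\<^bsub>L\<^esub> ?g" using fc by (simp add: Ls.add_minus_cancel)
    ultimately show ?thesis
      using tsx [OF ord_ge_carrier [OF g]] by (intro disjI2 bexI [of _ "?s \<otimes>\<^bsub>L\<^esub> ?g"]) simp_all
  qed
  show "\<exists>y\<in>V_L. y [^]\<^bsub>L\<^esub> m = \<one>\<^bsub>L\<^esub> \<oplus>\<^bsub>L\<^esub> ?t \<otimes>\<^bsub>L\<^esub> r" if r: "r \<in> V_L" for r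
  proof -
    let ?u = "\<one>\<^bsub>L\<^esub> \<oplus>\<^bsub>L\<^esub> ?t \<otimes>\<^bsub>L\<^esub> r"
    have tr: "?t \<otimes>\<^bsub>L\<^esub> r \<in> ord_ge 0" using ord_ge_mult [OF t V_LD(1) [OF r]] by simp
    have u: "?u \<in> ord_ge 0" by (rule ord_ge_add [OF L_one_ord_ge tr])
    have u0: "?u 0 = \<one> \<oplus> t \<otimes> r 0"
      using L_add [of "\<one>\<^bsub>L\<^esub>" _ 0] lowest_coeff_mult [OF t V_LD(1) [OF r]] L_one [of 0]
      by (simp add: mon_def)
    obtain c where c: "c \<in> V" "c [^] m = ?u 0" using hensel [OF V_LD(2) [OF r]] u0 by auto
    have "c \<noteq> \<zero>"
      using c(2) principal_unit_V0 [OF V_LD(2) [OF r]] m_ge u0 by (auto simp: V0_def nat_pow_zero)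
    from power_series_root [OF prime char_p Suc_m m_ge u V_sub [OF c(1)] this c(2)] c(1)
    show ?thesis by (auto simp: V_L_def)
  qed
  show "add_pow L p \<one>\<^bsub>L\<^esub> = \<zero>\<^bsub>L\<^esub>" by (rule L_char [OF char_p])
qed (use prime m_ge Suc_m in auto)

lemma henselian_valuation_image:
  assumes "inj h"
  shows "henselian_valuation (image_ring h R) (h ` V) (h t) p m e"
proof -
  let ?S = "image_ring h R"
  have inj: "inj_on h (carrier R)" using assms by (rule inj_on_subset) simp
  have iso: "h \<in> ring_iso R ?S" by (rule inj_imp_image_ring_iso [OF inj])
  interpret S: field ?S by (rule inj_imp_image_ring_is_field [OF inj])
  have hom: "h \<in> ring_hom R ?S" using iso by (simp add: ring_iso_def)
  interpret h: ring_hom_ring R ?S h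
    by (rule ring_hom_ringI2 [OF ring_axioms S.ring_axioms hom])
  have h_eq: "h x = h y \<longleftrightarrow> x = y" for x y using assms by (simp add: inj_eq)
  have h_pow: "h x [^]\<^bsub>?S\<^esub> (k::nat) = h (x [^] k)" if "x \<in> carrier R" for x k
    using that by (induction k) simp_all
  have h_add_pow: "add_pow ?S (k::nat) \<one>\<^bsub>?S\<^esub> = h (add_pow R k \<one>)" for k
    by (induction k) (simp_all add: S.add.nat_pow_Suc add.nat_pow_Suc)
  have h_unit: "\<one>\<^bsub>?S\<^esub> \<oplus>\<^bsub>?S\<^esub> h t \<otimes>\<^bsub>?S\<^esub> h r = h (\<one> \<oplus> t \<otimes> r)" if "r \<in> V" for r
    using V_sub [OF that] by simp
  have h_t: "h t \<otimes>\<^bsub>?S\<^esub> h r = h (t \<otimes> r)" if "r \<in> V" for r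
    using V_sub [OF that] by simp
  show ?thesis
  proof (intro henselian_valuation.intro henselian_valuation_axioms.intro S.field_axioms)
    show "subring (h ` V) ?S" by (rule h.img_is_subring [OF subring])
    show "h t \<in> h ` V" using t_in by blast
    show "h t \<noteq> \<zero>\<^bsub>?S\<^esub>" using t_nonzero by (simp flip: h.hom_zero add: h_eq)
    show "h t \<otimes>\<^bsub>?S\<^esub> r \<noteq> \<one>\<^bsub>?S\<^esub>" if "r \<in> h ` V" for r
      using that t_nonunit by (auto simp: h_t h_eq simp flip: h.hom_one)
    show "\<exists>r\<in>h ` V. x \<otimes>\<^bsub>?S\<^esub> (h t \<otimes>\<^bsub>?S\<^esub> r) = \<one>\<^bsub>?S\<^esub>" if x: "x \<in> carrier ?S" "x \<notin> h ` V" for x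
    proof -
      obtain x' where x': "x' \<in> carrier R" "x = h x'" using x(1) by (auto simp: image_ring_carrier)
      then have "x' \<notin> V" using x(2) by blast
      then obtain r where r: "r \<in> V" "x' \<otimes> (t \<otimes> r) = \<one>" using valuation x'(1) by blast
      have "x \<otimes>\<^bsub>?S\<^esub> (h t \<otimes>\<^bsub>?S\<^esub> h r) = h (x' \<otimes> (t \<otimes> r))"
        unfolding x'(2) h_t [OF r(1)]
        by (rule h.hom_mult [symmetric]) (use x'(1) V_sub [OF r(1)] in simp_all)
      also have "\<dots> = \<one>\<^bsub>?S\<^esub>" unfolding r(2) by (rule h.hom_one)
      finally show ?thesis using r(1) by blast
    qed
    show "(\<exists>r\<in>h ` V. x = h t \<otimes>\<^bsub>?S\<^esub> r) \<or> (\<exists>r\<in>h ` V. x [^]\<^bsub>?S\<^esub> m = \<one>\<^bsub>?S\<^esub> \<oplus>\<^bsub>?S\<^esub> h t \<otimes>\<^bsub>?S\<^esub> r)"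
      if x: "x \<in> h ` V" for x
    proof -
      obtain x' where x': "x' \<in> V" "x = h x'" using x by blast
      show ?thesis using residue [OF x'(1)]
      proof
        assume "\<exists>r\<in>V. x' = t \<otimes> r"
        then obtain r where "r \<in> V" "x' = t \<otimes> r" by blast
        then have "x = h t \<otimes>\<^bsub>?S\<^esub> h r" by (simp only: x'(2) h_t)
        with \<open>r \<in> V\<close> show ?thesis by blast
      next
        assume "\<exists>r\<in>V. x' [^] m = \<one> \<oplus> t \<otimes> r"
        then obtain r where "r \<in> V" "x' [^] m = \<one> \<oplus> t \<otimes> r" by blast
        then have "x [^]\<^bsub>?S\<^esub> m = \<one>\<^bsub>?S\<^esub> \<oplus>\<^bsub>?S\<^esub> h t \<otimes>\<^bsub>?S\<^esub> h r"
          by (simp only: x'(2) h_unit h_pow [OF V_sub [OF x'(1)]])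
        with \<open>r \<in> V\<close> show ?thesis by blast
      qed
    qed
    show "\<exists>y\<in>h ` V. y [^]\<^bsub>?S\<^esub> m = \<one>\<^bsub>?S\<^esub> \<oplus>\<^bsub>?S\<^esub> h t \<otimes>\<^bsub>?S\<^esub> r" if r: "r \<in> h ` V" for r
    proof -
      obtain r' where r': "r' \<in> V" "r = h r'" using r by blast
      obtain y where y: "y \<in> V" "y [^] m = \<one> \<oplus> t \<otimes> r'" using hensel [OF r'(1)] by blast
      then have "h y [^]\<^bsub>?S\<^esub> m = \<one>\<^bsub>?S\<^esub> \<oplus>\<^bsub>?S\<^esub> h t \<otimes>\<^bsub>?S\<^esub> r"
        by (simp only: r'(2) h_unit [OF r'(1)] h_pow [OF V_sub])
      with y(1) show ?thesis by blast
    qed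
    show "add_pow ?S p \<one>\<^bsub>?S\<^esub> = \<zero>\<^bsub>?S\<^esub>" by (simp add: h_add_pow char_p)
  qed (use prime m_ge Suc_m in auto)
qed

end

section \<open>Iterated Laurent series over a finite field\<close>

lemma (in field) finite_field_char:
  assumes "finite (carrier R)" "card (carrier R) = p ^ l" "Factorial_Ring.prime (p::nat)"
  shows "add_pow R p \<one> = \<zero>"
proof -
  have "add_pow R (p ^ l) \<one> = \<zero>"
    using add.power_order_eq_one [of \<one>] assms(1,2) by (simp add: order_def)
  moreover have "add_pow R (p ^ k) \<one> = (add_pow R p \<one>) [^] k" for k :: nat
  proof (induction k)
    case (Suc k)
    have "add_pow R (p ^ Suc k) \<one> = add_pow R p (add_pow R (p ^ k) \<one>)"
      by (simp add: add.nat_pow_pow mult.commute)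
    also have "\<dots> = add_pow R (p ^ k) \<one> \<otimes> add_pow R p \<one>"
      by (subst add_pow_rdistr) simp_all
    finally show ?case by (simp add: Suc)
  qed simp
  ultimately have "(add_pow R p \<one>) [^] l = \<zero>" by simp
  moreover have "c [^] k \<noteq> \<zero>" if "c \<in> carrier R" "c \<noteq> \<zero>" for c and k :: nat
    using that by (induction k) (auto simp: integral_iff)
  ultimately show ?thesis by blast
qed

lemma (in field) finite_field_power:
  assumes "finite (carrier R)" "x \<in> carrier R" "x \<noteq> \<zero>"
  shows "x [^] (card (carrier R) - 1) = \<one>"
proof -
  have "card (Units R) = card (carrier R) - 1" using assms(1) by (simp add: field_Units)
  moreover have "x \<in> Units R" using assms(2,3) by (simp add: field_Units)
  moreover have "finite (Units R)" using assms(1) by (simp add: field_Units)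
  ultimately show ?thesis using units_power_order_eq_one [of x] by simp
qed

lemma henselian_valuation_iter_laurent:
  fixes L :: "('a, 'b) ring_scheme"
  assumes "field L" "finite (carrier L)" "Factorial_Ring.prime p" "card (carrier L) = p ^ l" "n \<ge> 1"
  shows "\<exists>V t. henselian_valuation (iter_laurent L n) V t p (p ^ (2 * l) - 1) (2 * l)"
  using assms(5)
proof (induction n rule: dec_induct)
  case base
  \<comment> \<open>The exponent \<open>?q\<^sup>2 - 1\<close>, unlike \<open>?q - 1\<close>, is at least 2 even if \<open>?q\<close> is 2.\<close>
  let ?q = "p ^ l" and ?m = "p ^ (2 * l) - 1"
  let ?F = "image_ring Base L"
  interpret L: field L by fact
  have inj: "inj_on Base (carrier L)" by (simp add: inj_on_def)
  interpret F: field ?F by (rule L.inj_imp_image_ring_is_field [OF inj])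
  have fin: "finite (carrier ?F)" and card: "card (carrier ?F) = ?q"
    using assms(2,4) inj by (simp_all add: image_ring_carrier card_image)
  have "card {\<zero>\<^bsub>L\<^esub>, \<one>\<^bsub>L\<^esub>} \<le> card (carrier L)"
    using assms(2) by (intro card_mono) auto
  then have q: "?q \<ge> 2" using assms(4) by simp
  have "?q * ?q \<ge> 2 * 2" using q by (intro mult_le_mono) 
  moreover have pq: "p ^ (2 * l) = ?q * ?q" by (simp add: mult_2 power_add)
  ultimately have m: "Suc ?m = p ^ (2 * l)" "?m \<ge> 2" by simp_all
  have mq: "?m = (?q - 1) * (?q + 1)" unfolding pq by (simp add: algebra_simps)
  have "x [^]\<^bsub>?F\<^esub> ?m = \<one>\<^bsub>?F\<^esub>" if "x \<in> carrier ?F" "x \<noteq> \<zero>\<^bsub>?F\<^esub>" for x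
  proof -
    have "x [^]\<^bsub>?F\<^esub> ?m = (x [^]\<^bsub>?F\<^esub> (?q - 1)) [^]\<^bsub>?F\<^esub> (?q + 1)"
      unfolding mq using that(1) by (rule F.nat_pow_pow [symmetric])
    also have "x [^]\<^bsub>?F\<^esub> (?q - 1) = \<one>\<^bsub>?F\<^esub>"
      using F.finite_field_power [OF fin that] unfolding card .
    finally show ?thesis by (simp only: F.nat_pow_one)
  qed
  then have "henselian_valuation (laurent_ring ?F) (F.ord_ge 0) (F.mon 1 \<one>\<^bsub>?F\<^esub>) p ?m (2 * l)"
    using F.henselian_valuation_power_series [OF assms(3) F.finite_field_char [OF fin card assms(3)] m]
    by blast
  then interpret henselian_valuation "laurent_ring ?F" "F.ord_ge 0" "F.mon 1 \<one>\<^bsub>?F\<^esub>" p ?m "2 * l" .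
  have "inj Series" by (simp add: inj_def)
  from henselian_valuation_image [OF this] show ?case by auto
next
  case (step n)
  then obtain V t where "henselian_valuation (iter_laurent L n) V t p (p ^ (2 * l) - 1) (2 * l)"
    by blast
  then interpret henselian_valuation "iter_laurent L n" V t p "p ^ (2 * l) - 1" "2 * l" .
  interpret H: henselian_valuation "laurent_ring (iter_laurent L n)" V_L "mon 0 t" p "p ^ (2 * l) - 1" "2 * l"
    by (rule henselian_valuation_L)
  have "inj Series" by (simp add: inj_def)
  from H.henselian_valuation_image [OF this] show ?case by auto
qed

theorem theorem2:
  fixes L :: "('a, 'b) ring_scheme" and K :: "'a iter_series ring" and p l n :: nat
  assumes "field L"
    and "finite (carrier L)"
    and "Factorial_Ring.prime p"
    and "card (carrier L) = p ^ l"
    and "n \<ge> 1"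
    and "K = iter_laurent L n"
  shows "carrier (K0 K) = {\<zero>\<^bsub>K0 K\<^esub>} \<and>
    (\<exists>f. definable_bij K f (points (carrier K)) (points (carrier K - {\<zero>\<^bsub>K\<^esub>})))"
proof -
  obtain V t where "henselian_valuation K V t p (p ^ (2 * l) - 1) (2 * l)"
    using henselian_valuation_iter_laurent [OF assms(1-5)] unfolding assms(6) by blast
  then interpret henselian_valuation K V t p "p ^ (2 * l) - 1" "2 * l" .
  show ?thesis
    using K0_trivial [OF carrier_equiv_nonzero] definable_bij_points [OF carrier_equiv_nonzero] ..
qed

end
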